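(* Let $\varphi\in\mathcal I$ and let $\mu$ be a nonzero finite Borel measure on $S^{n-1}$ which is not concentrated on any closed hemisphere. Let $G\in\mathcal G_I$ be a continuous function such that, for some $q\ge n-1$, $$\inf\Big\{\frac{G(t,u)}{t^q}:\ t\ge 1,\ u\in S^{n-1}\Big\}>0.$$ Then the following statements hold. i) There exists a convex body $\widetilde M\in\widetilde{\mathcal B}$ such that $$\int_{S^{n-1}}\varphi(h_{\widetilde M}(u))\,d\mu(u)=\inf\Big\{\int_{S^{n-1}}\varphi(h_Q(u))\,d\mu(u):Q\in\widetilde{\mathcal B}\Big\}.$$ If, in addition, $\varphi$ is convex on $(0,\infty)$ and $t\mapsto G(t,u)$ is convex on $(0,\infty)$ for each $u\in S^{n-1}$, then such $\widetilde M\in\widetilde{\mathcal B}$ is unique. ii) There exists a convex body $\widehat M\in\widehat{\mathcal B}$ such that $$\int_{S^{n-1}}\varphi(h_{\widehat M}(u))\,d\mu(u)=\inf\Big\{\int_{S^{n-1}}\varphi(h_Q(u))\,d\mu(u):Q\in\widehat{\mathcal B}\Big\}.$$ If, in addition, $\varphi$ is convex on $(0,\infty)$ and $t\mapsto G(t,u)$ is convex on $(0,\infty)$ for each $u\in S^{n-1}$, then such $\widehat M\in\widehat{\mathcal B}$ is unique.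
   Context: Work in $\mathbb R^n$, $n\ge2$, with inner product $\langle\cdot,\cdot\rangle$, unit ball $B^n$ and unit sphere $S^{n-1}$; $du$ denotes the spherical measure on $S^{n-1}$ (the $(n-1)$-dimensional Hausdorff measure). $\mathcal K_{(o)}^n$ is the set of compact convex subsets of $\mathbb R^n$ with the origin $o$ in their interiors. For $K\in\mathcal K_{(o)}^n$ and $u\in S^{n-1}$: $h_K(u)=\max_{x\in K}\langle x,u\rangle$, $\rho_K(u)=\max\{\lambda\ge0:\lambda u\in K\}$, and $K^\circ=\{x\in\mathbb R^n:\langle x,y\rangle\le1\ \forall y\in K\}$. $\mathcal I$ is the set of continuous strictly increasing functions $\varphi:(0,\infty)\to(0,\infty)$ with $\lim_{t\to0^+}\varphi(t)=0$, $\varphi(1)=1$, $\lim_{t\to\infty}\varphi(t)=\infty$. $\mathcal G_I$ is the set of continuous $G:(0,\infty)\times S^{n-1}\to(0,\infty)$ such that for each $u\in S^{n-1}$, $t\mapsto G(t,u)$ is strictly increasing with $\lim_{t\to0^+}G(t,u)=0$ and $\lim_{t\to\infty}G(t,u)=\infty$. The general dual volume is $\widetilde V_G(K)=\int_{S^{n-1}}G(\rho_K(u),u)\,du$ for $K\in\mathcal K_{(o)}^n$. For $G\in\mathcal G_I$ the homogeneous general dual volume is $\widehat V_G(K)=\inf\{\eta>0:\int_{S^{n-1}}G(\rho_K(u)/\eta,u)\,du\le1\}$. Set $$\widetilde{\mathcal B}=\{Q\in\mathcal K_{(o)}^n:\widetilde V_G(Q^\circ)=\widetilde V_G(B^n)\},\qquad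 \widehat{\mathcal B}=\{Q\in\mathcal K_{(o)}^n:\widehat V_G(Q^\circ)=\widehat V_G(B^n)\}.$$ A finite Borel measure $\mu$ on $S^{n-1}$ is not concentrated on any closed hemisphere if $\mu(\{u\in S^{n-1}:\langle u,v\rangle>0\})>0$ for every $v\in S^{n-1}$. *)

theory Defs
  imports "HOL-Analysis.Analysis"
begin

section \<open>Hausdorff measure and the spherical measure\<close>

text \<open>
  The usual normalisation is used: a set of diameter \<open>d\<close> contributes
  \<open>\<omega>\<^sub>k (d / 2) ^ k\<close>, with \<open>\<omega>\<^sub>k\<close> the volume of the \<open>k\<close>-dimensional unit ball.
  Boundedness of the covering sets is demanded explicitly because the
  library's \<^const>\<open>diameter\<close> is unspecified on unbounded sets; empty covering sets
  contribute 0 also for \<open>k = 0\<close> (where \<open>0 ^ 0 = 1\<close>).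
\<close>

definition hausdorff_premeasure :: "nat \<Rightarrow> real \<Rightarrow> 'a::metric_space set \<Rightarrow> ennreal" where
  "hausdorff_premeasure k \<delta> A =
     (INF C\<in>{C :: nat \<Rightarrow> 'a set.
               A \<subseteq> (\<Union>i. C i) \<and> (\<forall>i. bounded (C i) \<and> diameter (C i) \<le> \<delta>)}.
        \<Sum>i. if C i = {} then 0
             else ennreal (unit_ball_vol (real k) * (diameter (C i) / 2) ^ k))"

definition hausdorff_outer :: "nat \<Rightarrow> 'a::metric_space set \<Rightarrow> ennreal" where
  "hausdorff_outer k A = (SUP \<delta>\<in>{0<..}. hausdorff_premeasure k \<delta> A)"

text \<open>
  \<^const>\<open>hausdorff_outer\<close> is a metric outer measure, hence countably additive on the
  Borel sets, so \<^const>\<open>measure_of\<close> does not fall back to the zero measure here.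
\<close>

definition hausdorff_measure :: "nat \<Rightarrow> 'a::metric_space measure" where
  "hausdorff_measure k = measure_of UNIV (sets borel) (hausdorff_outer k)"

definition spherical_measure :: "'a::euclidean_space measure" where
  "spherical_measure = restrict_space (hausdorff_measure (DIM('a) - 1)) (sphere 0 1)"

section \<open>Convex bodies\<close>

definition convex_bodies_o :: "'a::euclidean_space set set" where
  "convex_bodies_o = {K. compact K \<and> convex K \<and> 0 \<in> interior K}"

text \<open>
  For \<open>K\<close> in \<^const>\<open>convex_bodies_o\<close> the suprema in the next two definitions are maxima,
  by compactness.
\<close>

definition support_fun :: "'a::euclidean_space set \<Rightarrow> 'a \<Rightarrow> real" where
  "support_fun K u = (SUP x\<in>K. x \<bullet> u)"

definition radial_fun :: "'a::euclidean_space set \<Rightarrow> 'a \<Rightarrow> real" where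
  "radial_fun K u = Sup {r. 0 \<le> r \<and> r *\<^sub>R u \<in> K}"

definition polar_body :: "'a::euclidean_space set \<Rightarrow> 'a set" where
  "polar_body K = {x. \<forall>y\<in>K. x \<bullet> y \<le> 1}"

section \<open>Orlicz functions\<close>

text \<open>Functions on \<open>(0, \<infinity>)\<close> are total functions of which only the values on
  \<open>{0<..}\<close> matter.\<close>

definition class_I :: "(real \<Rightarrow> real) set" where
  "class_I = {\<phi>. continuous_on {0<..} \<phi> \<and> strict_mono_on {0<..} \<phi> \<and> (\<forall>t>0. \<phi> t > 0) \<and>
                 (\<phi> \<longlongrightarrow> 0) (at_right 0) \<and> \<phi> 1 = 1 \<and> filterlim \<phi> at_top at_top}"

definition class_G_I :: "(real \<Rightarrow> 'a::euclidean_space \<Rightarrow> real) set" where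
  "class_G_I = {G. continuous_on ({0<..} \<times> sphere 0 1) (\<lambda>(t, u). G t u) \<and>
                   (\<forall>t>0. \<forall>u\<in>sphere 0 1. G t u > 0) \<and>
                   (\<forall>u\<in>sphere 0 1. strict_mono_on {0<..} (\<lambda>t. G t u) \<and>
                      ((\<lambda>t. G t u) \<longlongrightarrow> 0) (at_right 0) \<and>
                      filterlim (\<lambda>t. G t u) at_top at_top)}"

section \<open>General dual volumes\<close>

definition dual_vol :: "(real \<Rightarrow> 'a::euclidean_space \<Rightarrow> real) \<Rightarrow> 'a set \<Rightarrow> real" where
  "dual_vol G K = (\<integral>u. G (radial_fun K u) u \<partial>spherical_measure)"

definition hom_dual_vol :: "(real \<Rightarrow> 'a::euclidean_space \<Rightarrow> real) \<Rightarrow> 'a set \<Rightarrow> real" where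
  "hom_dual_vol G K =
     Inf {\<eta>. \<eta> > 0 \<and> (\<integral>u. G (radial_fun K u / \<eta>) u \<partial>spherical_measure) \<le> 1}"

definition B_tilde :: "(real \<Rightarrow> 'a::euclidean_space \<Rightarrow> real) \<Rightarrow> 'a set set" where
  "B_tilde G = {Q \<in> convex_bodies_o. dual_vol G (polar_body Q) = dual_vol G (cball 0 1)}"

definition B_hat :: "(real \<Rightarrow> 'a::euclidean_space \<Rightarrow> real) \<Rightarrow> 'a set set" where
  "B_hat G = {Q \<in> convex_bodies_o. hom_dual_vol G (polar_body Q) = hom_dual_vol G (cball 0 1)}"

section \<open>Measures on the sphere\<close>

definition finite_borel_measure_on_sphere :: "'a::euclidean_space measure \<Rightarrow> bool" where
  "finite_borel_measure_on_sphere \<mu> \<longleftrightarrow>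
     sets \<mu> = sets (restrict_space borel (sphere 0 1)) \<and> finite_measure \<mu>"

definition not_concentrated_on_closed_hemisphere :: "'a::euclidean_space measure \<Rightarrow> bool" where
  "not_concentrated_on_closed_hemisphere \<mu> \<longleftrightarrow>
     (\<forall>v\<in>sphere 0 1. emeasure \<mu> {u \<in> sphere 0 1. u \<bullet> v > 0} > 0)"

end

theory Submission
  imports Defs "HOL-Complex_Analysis.Great_Picard"
begin

text \<open>
  Since the radial function of the polar body is \<open>1 / h\<^sub>Q\<close> and the support functions of bodies
  with the origin in the interior are exactly the sublinear functions \<open>h\<close> that are positive off the
  origin, both problems minimise \<open>\<integral>\<phi>(h) d\<mu>\<close> under a constraint on \<open>\<integral>G(1 / h(u), u) du\<close>.
  If \<open>r\<close> is the homogeneous dual volume of the unit ball, then the second constraint is the first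
  one for \<open>(t, u) \<mapsto> G(t / r, u)\<close>, so only the first problem has to be solved.

  A minimizing sequence is bounded because \<open>\<mu>\<close> charges every open hemisphere uniformly, so a subsequence
  of support functions converges uniformly on the sphere to a sublinear limit \<open>h\<close>. If \<open>h\<close> vanished at a point \<open>v\<close>,
  then \<open>1 / h(u)\<close> would be at least of order \<open>1 / \<bar>u - v\<bar>\<close>, whose power \<open>n - 1\<close> is not
  integrable on the sphere; Fatou's lemma and the growth of \<open>G\<close> exclude this, and \<open>h\<close> belongs to a minimizer.
\<close>

section \<open>Hausdorff measure as a metric outer measure\<close>

text \<open>The spherical measure comes from the raw Hausdorff construction, so every property of it
  has to be earned. Three facts suffice: the sphere has finite measure, nonempty relatively open
  subsets have positive measure, and a cap of radius 1/N has measure at least a constant times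
  1/N^(n-1). The last one follows by comparison with Lebesgue volume in the whole space; a wasteful
  constant is harmless there, because divergence of an integral and positivity depend only on the
  order of magnitude.

  The exponent n - 1 is the dimension of the sphere, hence the first power at which a point
  singularity stops being integrable; this is where the lower limit for \<open>q\<close> comes from.

  The homogeneous volume is an infimum over scales. Since the volume belonging to
  \<open>r * h\<close> decreases strictly and continuously in \<open>r\<close> and takes every
  positive value, that infimum is the only scale of volume 1, and equality of two such infima turns
  into an equation between integrals.\<close>

definition hausdorff_weight :: "nat \<Rightarrow> 'a::metric_space set \<Rightarrow> ennreal" where
  "hausdorff_weight k C = (if C = {} then 0 else ennreal (unit_ball_vol (real k) * (diameter C / 2) ^ k))"

lemma hausdorff_weight_empty [simp]: "hausdorff_weight k {} = 0"
  by (simp add: hausdorff_weight_def)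

definition hausdorff_covers :: "real \<Rightarrow> 'a::metric_space set \<Rightarrow> (nat \<Rightarrow> 'a set) set" where
  "hausdorff_covers \<delta> A = {C. A \<subseteq> (\<Union>i. C i) \<and> (\<forall>i. bounded (C i) \<and> diameter (C i) \<le> \<delta>)}"

lemma hausdorff_premeasure_eq:
  "hausdorff_premeasure k \<delta> A = (INF C\<in>hausdorff_covers \<delta> A. \<Sum>i. hausdorff_weight k (C i))"
  unfolding hausdorff_premeasure_def hausdorff_weight_def hausdorff_covers_def by simp

lemma hausdorff_premeasure_le_suminf:
  "C \<in> hausdorff_covers \<delta> A \<Longrightarrow> hausdorff_premeasure k \<delta> A \<le> (\<Sum>i. hausdorff_weight k (C i))"
  unfolding hausdorff_premeasure_eq by (rule INF_lower)

lemma hausdorff_premeasure_mono: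
  assumes "A \<subseteq> B" and "\<delta>' \<le> \<delta>"
  shows "hausdorff_premeasure k \<delta> A \<le> hausdorff_premeasure k \<delta>' B"
  unfolding hausdorff_premeasure_eq
proof (rule INF_superset_mono)
  show "hausdorff_covers \<delta>' B \<subseteq> hausdorff_covers \<delta> A"
    using assms unfolding hausdorff_covers_def by (blast intro: order_trans)
qed simp

lemma hausdorff_premeasure_empty: "0 \<le> \<delta> \<Longrightarrow> hausdorff_premeasure k \<delta> {} = 0"
  using hausdorff_premeasure_le_suminf[of "\<lambda>_. {}" \<delta> "{}" k]
  by (simp add: hausdorff_covers_def)

lemma hausdorff_premeasure_UN_le:
  fixes A :: "nat \<Rightarrow> 'a::metric_space set"
  shows "hausdorff_premeasure k \<delta> (\<Union>i. A i) \<le> (\<Sum>i. hausdorff_premeasure k \<delta> (A i))"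
proof (rule ennreal_le_epsilon)
  fix e :: real
  assume e: "0 < e" and fin: "(\<Sum>n. hausdorff_premeasure k \<delta> (A n)) < top"
  \<comment> \<open>\<open>ennreal_le_epsilon\<close> lets the sum be taken finite. Then each
    summand is finite, and only then does adding \<open>e * (1/2)^Suc n\<close> give something
    strictly larger, hence a cover that close to the infimum.\<close>
  then have *: "hausdorff_premeasure k \<delta> (A n) < hausdorff_premeasure k \<delta> (A n) + e * (1/2)^Suc n" for n
    by (auto simp add: less_top dest!: ennreal_suminf_lessD)
  have "\<exists>C. C \<in> hausdorff_covers \<delta> (A n) \<and>
      (\<Sum>i. hausdorff_weight k (C i)) \<le> hausdorff_premeasure k \<delta> (A n) + e * (1/2)^Suc n" for n
    using *[of n] unfolding hausdorff_premeasure_eq INF_less_iff by (blast intro: less_imp_le)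
  then obtain B where B: "\<And>n. B n \<in> hausdorff_covers \<delta> (A n)"
    and Ble: "\<And>n. (\<Sum>i. hausdorff_weight k (B n i)) \<le> hausdorff_premeasure k \<delta> (A n) + e * (1/2)^Suc n"
    by metis
  define C where "C = case_prod B \<circ> prod_decode"
  have "C \<in> hausdorff_covers \<delta> (\<Union>i. A i)"
  proof -
    have "x \<in> (\<Union>i. C i)" if "x \<in> A n" for x n
    proof -
      have "A n \<subseteq> (\<Union>i. B n i)" using B[of n] by (simp add: hausdorff_covers_def)
      with that obtain i where "x \<in> B n i" by blast
      then have "x \<in> C (prod_encode (n, i))" by (simp add: C_def)
      then show ?thesis by blast
    qed
    then show ?thesis
      using B by (auto simp: hausdorff_covers_def C_def split: prod.split)
  qed
  then have "hausdorff_premeasure k \<delta> (\<Union>i. A i) \<le> (\<Sum>i. hausdorff_weight k (C i))"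
    by (rule hausdorff_premeasure_le_suminf)
  also have "\<dots> = (\<Sum>n. \<Sum>i. hausdorff_weight k (B n i))"
    unfolding C_def comp_def
    using suminf_ennreal_2dimen[where f = "\<lambda>p. hausdorff_weight k (case_prod B p)"] by simp
  also have "\<dots> \<le> (\<Sum>n. hausdorff_premeasure k \<delta> (A n) + e * (1/2) ^ Suc n)"
    by (intro suminf_le Ble) auto
  also have "\<dots> = (\<Sum>n. hausdorff_premeasure k \<delta> (A n)) + (\<Sum>n. ennreal e * ennreal ((1/2) ^ Suc n))"
    using \<open>0 < e\<close> by (subst suminf_add[symmetric])
                       (auto simp del: ennreal_suminf_cmult simp add: ennreal_mult[symmetric])
  also have "\<dots> = (\<Sum>n. hausdorff_premeasure k \<delta> (A n)) + e"
    unfolding ennreal_suminf_cmult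
    by (subst suminf_ennreal_eq[OF zero_le_power power_half_series]) auto
  finally show "hausdorff_premeasure k \<delta> (\<Union>i. A i) \<le> (\<Sum>n. hausdorff_premeasure k \<delta> (A n)) + e" .
qed

lemma hausdorff_premeasure_le_outer: "0 < \<delta> \<Longrightarrow> hausdorff_premeasure k \<delta> A \<le> hausdorff_outer k A"
  unfolding hausdorff_outer_def by (rule SUP_upper) simp

lemma hausdorff_outer_empty [simp]: "hausdorff_outer k {} = 0"
  unfolding hausdorff_outer_def
  by (simp add: hausdorff_premeasure_empty cong: SUP_cong_simp)

lemma hausdorff_outer_mono: "A \<subseteq> B \<Longrightarrow> hausdorff_outer k A \<le> hausdorff_outer k B"
  unfolding hausdorff_outer_def by (rule SUP_mono) (auto intro: hausdorff_premeasure_mono)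

lemma hausdorff_outer_UN_le:
  fixes A :: "nat \<Rightarrow> 'a::metric_space set"
  shows "hausdorff_outer k (\<Union>i. A i) \<le> (\<Sum>i. hausdorff_outer k (A i))"
  unfolding hausdorff_outer_def[of k "\<Union>i. A i"]
proof (rule SUP_least)
  fix \<delta> :: real assume "\<delta> \<in> {0<..}"
  then have "(\<Sum>i. hausdorff_premeasure k \<delta> (A i)) \<le> (\<Sum>i. hausdorff_outer k (A i))"
    by (intro suminf_le hausdorff_premeasure_le_outer) auto
  then show "hausdorff_premeasure k \<delta> (\<Union>i. A i) \<le> (\<Sum>i. hausdorff_outer k (A i))"
    using hausdorff_premeasure_UN_le order_trans by blast
qed

lemma outer_measure_space_hausdorff: "outer_measure_space (Pow UNIV) (hausdorff_outer k)"
  by (auto simp: outer_measure_space_def positive_def increasing_def countably_subadditive_def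
      hausdorff_outer_mono hausdorff_outer_UN_le)

text \<open>Once the mesh is below \<open>d\<close>, no covering set meets both \<open>A\<close> and
  \<open>B\<close>, so a cover of the union splits into covers of the two parts that share no
  weight.\<close>

lemma hausdorff_outer_separated:
  fixes A B :: "'a::metric_space set"
  assumes d: "0 < d" and sep: "\<And>x y. x \<in> A \<Longrightarrow> y \<in> B \<Longrightarrow> d \<le> dist x y"
  shows "hausdorff_outer k A + hausdorff_outer k B \<le> hausdorff_outer k (A \<union> B)"
proof -
  have small: "hausdorff_premeasure k \<delta> A + hausdorff_premeasure k \<delta> B \<le> hausdorff_premeasure k \<delta> (A \<union> B)"
    if \<delta>: "0 < \<delta>" "\<delta> < d" for \<delta>
    unfolding hausdorff_premeasure_eq[of k \<delta> "A \<union> B"]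
  proof (rule INF_greatest)
    fix C assume C: "C \<in> hausdorff_covers \<delta> (A \<union> B)"
    \<comment> \<open>Discarded sets become empty, and the empty set has weight 0 for every
      \<open>k\<close>.\<close>
    define CA where "CA i = (if C i \<inter> A = {} then {} else C i)" for i
    define CB where "CB i = (if C i \<inter> B = {} then {} else C i)" for i
    have "CA \<in> hausdorff_covers \<delta> A" "CB \<in> hausdorff_covers \<delta> B"
      using C \<delta> unfolding hausdorff_covers_def CA_def CB_def by (fastforce split: if_splits)+
    then have "hausdorff_premeasure k \<delta> A + hausdorff_premeasure k \<delta> B
        \<le> (\<Sum>i. hausdorff_weight k (CA i)) + (\<Sum>i. hausdorff_weight k (CB i))"
      by (intro add_mono hausdorff_premeasure_le_suminf)
    also have "\<dots> = (\<Sum>i. hausdorff_weight k (CA i) + hausdorff_weight k (CB i))"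
      by (rule suminf_add) auto
    also have "\<dots> \<le> (\<Sum>i. hausdorff_weight k (C i))"
    proof (intro suminf_le)
      fix i
      have "C i \<inter> A = {} \<or> C i \<inter> B = {}"
      proof (rule ccontr)
        assume "\<not> ?thesis"
        then obtain x y where "x \<in> C i" "x \<in> A" "y \<in> C i" "y \<in> B" by blast
        moreover have "bounded (C i)" "diameter (C i) \<le> \<delta>"
          using C by (auto simp: hausdorff_covers_def)
        ultimately show False
          using diameter_bounded_bound[of "C i" x y] sep[of x y] \<delta> by auto
      qed
      then show "hausdorff_weight k (CA i) + hausdorff_weight k (CB i) \<le> hausdorff_weight k (C i)"
        by (auto simp: CA_def CB_def)
    qed auto
    finally show "hausdorff_premeasure k \<delta> A + hausdorff_premeasure k \<delta> B
        \<le> (\<Sum>i. hausdorff_weight k (C i))" .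
  qed
  have "hausdorff_premeasure k a A + hausdorff_premeasure k b B \<le> hausdorff_outer k (A \<union> B)"
    if "0 < a" "0 < b" for a b
  proof -
    \<comment> \<open>Shrinking the mesh only raises the premeasure, so the two independent meshes
      may be replaced by a common one below \<open>d\<close>.\<close>
    define \<delta> where "\<delta> = min (min a b) (d/2)"
    have \<delta>: "0 < \<delta>" "\<delta> < d" "\<delta> \<le> a" "\<delta> \<le> b" using that d by (auto simp: \<delta>_def)
    have "hausdorff_premeasure k a A + hausdorff_premeasure k b B
        \<le> hausdorff_premeasure k \<delta> A + hausdorff_premeasure k \<delta> B"
      by (intro add_mono hausdorff_premeasure_mono \<delta>) auto
    also have "\<dots> \<le> hausdorff_premeasure k \<delta> (A \<union> B)" by (rule small[OF \<delta>(1,2)])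
    also have "\<dots> \<le> hausdorff_outer k (A \<union> B)" by (rule hausdorff_premeasure_le_outer[OF \<delta>(1)])
    finally show ?thesis .
  qed
  then show ?thesis
    unfolding hausdorff_outer_def[of k A] hausdorff_outer_def[of k B]
    by (simp add: ennreal_SUP_add_left[symmetric] ennreal_SUP_add_right SUP_le_iff)
qed

lemma hausdorff_outer_Un_le: "hausdorff_outer k (A \<union> B) \<le> hausdorff_outer k A + hausdorff_outer k B"
proof -
  have "hausdorff_outer k (\<Union>i. (binaryset A B) i) \<le> (\<Sum>i. hausdorff_outer k (binaryset A B i))"
    by (rule hausdorff_outer_UN_le)
  then show ?thesis
    by (simp add: UN_binaryset_eq suminf_binaryset_eq)
qed

text \<open>Caratheodory's criterion: the set \<open>A - F\<close> is exhausted by the sets of points at distance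
  at least \<open>1 / (n + 1)\<close> from \<open>F\<close>; the layers of the remainder of equal parity are pairwise separated, so their
  measures are summable.\<close>
lemma hausdorff_outer_closed_split:
  fixes F :: "'a::metric_space set"
  assumes "closed F"
  shows "hausdorff_outer k (A \<inter> F) + hausdorff_outer k (A - F) \<le> hausdorff_outer k A"
proof (cases "F = {} \<or> hausdorff_outer k A = top")
  case True
  then show ?thesis by auto
next
  case False
  then have F: "F \<noteq> {}" and fin: "hausdorff_outer k A < top" by (auto simp: less_top)
  define D where "D n = {x \<in> A. 1 / real (Suc n) \<le> infdist x F}" for n
  define R where "R n = {x \<in> A. 1 / real (Suc (Suc n)) \<le> infdist x F \<and> infdist x F < 1 / real (Suc n)}" for n
  have infd: "infdist x F \<le> infdist y F + dist x y" for x y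
    by (rule infdist_triangle)
  have AF: "hausdorff_outer k (A \<inter> F) + hausdorff_outer k (D n) \<le> hausdorff_outer k A" for n
  proof -
    have "hausdorff_outer k (A \<inter> F) + hausdorff_outer k (D n) \<le> hausdorff_outer k (A \<inter> F \<union> D n)"
    proof (rule hausdorff_outer_separated)
      fix x y assume "x \<in> A \<inter> F" "y \<in> D n"
      then show "1 / real (Suc n) \<le> dist x y"
        using infdist_le[of x F y] by (auto simp: D_def dist_commute)
    qed simp
    also have "\<dots> \<le> hausdorff_outer k A" by (rule hausdorff_outer_mono) (auto simp: D_def)
    finally show ?thesis .
  qed
  \<comment> \<open>Points of \<open>R n\<close> have distance at least 1/(n+2) from
    \<open>F\<close>, points of a layer \<open>i \<ge> n + 2\<close> less than 1/(n+3). The skipped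
    layer \<open>n + 1\<close> provides the gap.\<close>
  have RR: "hausdorff_outer k (R n) + hausdorff_outer k (\<Union>i\<in>I. R i) \<le> hausdorff_outer k (R n \<union> (\<Union>i\<in>I. R i))"
    if I: "\<And>i. i \<in> I \<Longrightarrow> n + 2 \<le> i" for n I
  proof (rule hausdorff_outer_separated)
    show "0 < 1 / real (Suc (Suc n)) - 1 / real (Suc (Suc (Suc n)))"
      by (simp add: frac_less2)
    fix x y assume x: "x \<in> R n" and "y \<in> (\<Union>i\<in>I. R i)"
    then obtain i where i: "i \<in> I" "y \<in> R i" by auto
    have "infdist y F < 1 / real (Suc i)" using i by (auto simp: R_def)
    also have "\<dots> \<le> 1 / real (Suc (Suc (Suc n)))" using I[OF i(1)] by (intro divide_left_mono) auto
    finally have "infdist y F < 1 / real (Suc (Suc (Suc n)))" .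
    moreover have "1 / real (Suc (Suc n)) \<le> infdist x F" using x by (auto simp: R_def)
    ultimately show "1 / real (Suc (Suc n)) - 1 / real (Suc (Suc (Suc n))) \<le> dist x y"
      using infd[of x y] by linarith
  qed
  have sums: "(\<Sum>i<n. hausdorff_outer k (R (2 * i + p))) \<le> hausdorff_outer k A" for n p
  proof -
    \<comment> \<open>Here \<open>p\<close> selects the parity. The starting layer \<open>m\<close>
      is generalised so that the induction can peel off the first layer and still meet a union of
      the same shape.\<close>
    have "(\<Sum>i<n. hausdorff_outer k (R (2 * (m + i) + p))) \<le> hausdorff_outer k (\<Union>i\<in>{i. \<exists>j\<ge>m. i = 2 * j + p}. R i)" for m
    proof (induction n arbitrary: m)
      case 0
      show ?case by simp
    next
      case (Suc n)
      have "(\<Sum>i<Suc n. hausdorff_outer k (R (2 * (m + i) + p)))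
          = hausdorff_outer k (R (2 * m + p)) + (\<Sum>i<n. hausdorff_outer k (R (2 * (Suc m + i) + p)))"
        by (subst sum.lessThan_Suc_shift) (simp add: algebra_simps)
      also have "\<dots> \<le> hausdorff_outer k (R (2 * m + p)) + hausdorff_outer k (\<Union>i\<in>{i. \<exists>j\<ge>Suc m. i = 2 * j + p}. R i)"
        by (intro add_left_mono Suc.IH)
      also have "\<dots> \<le> hausdorff_outer k (R (2 * m + p) \<union> (\<Union>i\<in>{i. \<exists>j\<ge>Suc m. i = 2 * j + p}. R i))"
        by (rule RR) auto
      also have "\<dots> \<le> hausdorff_outer k (\<Union>i\<in>{i. \<exists>j\<ge>m. i = 2 * j + p}. R i)"
        by (rule hausdorff_outer_mono) (auto intro: Suc_leD)
      finally show ?case .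
    qed
    from this[of 0] have "(\<Sum>i<n. hausdorff_outer k (R (2 * i + p))) \<le> hausdorff_outer k (\<Union>i\<in>{i. \<exists>j\<ge>0. i = 2 * j + p}. R i)" by simp
    also have "\<dots> \<le> hausdorff_outer k A" by (rule hausdorff_outer_mono) (auto simp: R_def)
    finally show ?thesis .
  qed
  have even_odd: "(\<Sum>i<2*n. f i) = (\<Sum>i<n. f (2 * i + 0)) + (\<Sum>i<n. f (2 * i + 1))" for f :: "nat \<Rightarrow> ennreal" and n
    by (induction n) (auto simp: algebra_simps)
  have part: "(\<Sum>i<n. hausdorff_outer k (R i)) \<le> hausdorff_outer k A + hausdorff_outer k A" for n
  proof -
    have "(\<Sum>i<n. hausdorff_outer k (R i)) \<le> (\<Sum>i<2*n. hausdorff_outer k (R i))"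
      by (rule sum_mono2) auto
    also have "\<dots> \<le> hausdorff_outer k A + hausdorff_outer k A"
      unfolding even_odd by (intro add_mono sums)
    finally show ?thesis .
  qed
  have total: "(\<Sum>i. hausdorff_outer k (R i)) < top"
  proof -
    have "(\<Sum>i. hausdorff_outer k (R i)) \<le> hausdorff_outer k A + hausdorff_outer k A"
      by (rule suminf_le_const[OF summableI part])
    also have "\<dots> < top" using fin by (simp add: less_top)
    finally show ?thesis .
  qed
  have le: "hausdorff_outer k (A \<inter> F) + hausdorff_outer k (A - F)
      \<le> hausdorff_outer k A + (\<Sum>i. hausdorff_outer k (R (i + n)))" for n
  proof -
    have "A - F \<subseteq> D n \<union> (\<Union>i. R (i + n))"
    proof
      fix x assume x: "x \<in> A - F"
      then have pos: "0 < infdist x F"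
        using in_closed_iff_infdist_zero[OF assms F] infdist_nonneg[of x F] by (simp add: order_less_le)
      show "x \<in> D n \<union> (\<Union>i. R (i + n))"
      proof (cases "1 / real (Suc n) \<le> infdist x F")
        case False
        \<comment> \<open>The least \<open>m\<close> with \<open>P m\<close> is positive, and its
          predecessor is the index of the layer that contains \<open>x\<close>.\<close>
        define P where "P = (\<lambda>m. 1 / real (Suc m) \<le> infdist x F)"
        have ex: "\<exists>m. P m" using reals_Archimedean[OF pos] by (auto simp: P_def inverse_eq_divide intro: less_imp_le)
        define m where "m = (LEAST m. P m)"
        have m: "P m" unfolding m_def by (rule LeastI_ex[OF ex])
        have "\<not> P n" using False by (simp add: P_def)
        have "n < m"
        proof (rule ccontr)
          assume "\<not> n < m"
          then have "1 / real (Suc n) \<le> 1 / real (Suc m)" by (intro divide_left_mono) auto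
          with m \<open>\<not> P n\<close> show False by (simp add: P_def)
        qed
        then obtain j where j: "m = Suc j" "n \<le> j" by (cases m) auto
        have "\<not> P j" using not_less_Least[of j P] j by (simp add: m_def)
        then have "x \<in> R j" using x m j by (auto simp: R_def P_def)
        then have "x \<in> R ((j - n) + n)" using j by simp
        then show ?thesis by blast
      qed (use x in \<open>simp add: D_def\<close>)
    qed
    then have "hausdorff_outer k (A - F) \<le> hausdorff_outer k (D n \<union> (\<Union>i. R (i + n)))"
      by (rule hausdorff_outer_mono)
    also have "\<dots> \<le> hausdorff_outer k (D n) + (\<Sum>i. hausdorff_outer k (R (i + n)))"
      using hausdorff_outer_Un_le hausdorff_outer_UN_le[of k "\<lambda>i. R (i + n)"] add_left_mono order_trans by blast
    finally have "hausdorff_outer k (A \<inter> F) + hausdorff_outer k (A - F)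
      \<le> (hausdorff_outer k (A \<inter> F) + hausdorff_outer k (D n)) + (\<Sum>i. hausdorff_outer k (R (i + n)))"
      by (simp add: add.assoc add_left_mono)
    also have "\<dots> \<le> hausdorff_outer k A + (\<Sum>i. hausdorff_outer k (R (i + n)))"
      by (intro add_right_mono AF)
    finally show ?thesis .
  qed
  \<comment> \<open>The finite total makes the layers a convergent series of reals; its tails
    vanish, and with them the error term in \<open>le\<close>.\<close>
  have "(\<lambda>n. \<Sum>i. hausdorff_outer k (R (i + n))) \<longlonglongrightarrow> 0"
  proof -
    define r where "r i = enn2real (hausdorff_outer k (R i))" for i
    have r_nonneg: "0 \<le> r i" for i by (simp add: r_def)
    have R: "hausdorff_outer k (R i) = ennreal (r i)" for i
      using fin hausdorff_outer_mono[of "R i" A k] unfolding r_def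
      by (subst ennreal_enn2real) (auto simp: R_def)
    have "summable r"
      using total unfolding R by (intro summable_suminf_not_top) (auto simp: r_nonneg)
    moreover have "(\<Sum>i. hausdorff_outer k (R (i + n))) = ennreal (\<Sum>i. r (i + n))" for n
      unfolding R using \<open>summable r\<close> by (intro suminf_ennreal2) (simp_all add: summable_ignore_initial_segment r_nonneg)
    ultimately show ?thesis
      using tendsto_ennrealI[OF suminf_exist_split2] by simp
  qed
  then have "(\<lambda>n. hausdorff_outer k A + (\<Sum>i. hausdorff_outer k (R (i + n)))) \<longlonglongrightarrow> hausdorff_outer k A + 0"
    by (intro tendsto_add tendsto_const)
  then show ?thesis
    using le by (intro LIMSEQ_le_const) auto
qed

section \<open>From the outer measure to the Borel measure\<close>

lemma sets_hausdorff_measure [simp]: "sets (hausdorff_measure k :: 'a::metric_space measure) = sets borel"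
  unfolding hausdorff_measure_def using sets.sets_measure_of_eq[of "borel :: 'a measure"] by simp

lemma space_hausdorff_measure [simp]: "space (hausdorff_measure k) = UNIV"
  unfolding hausdorff_measure_def by (simp add: space_measure_of_conv)

text \<open>The Caratheodory-measurable sets form a sigma-algebra on which the outer measure is
  countably additive. It contains the closed sets by the splitting above, hence all Borel sets,
  which is what \<open>measure_of\<close> requires to keep the prescribed values.\<close>

lemma emeasure_hausdorff_measure:
  fixes A :: "'a::metric_space set"
  assumes "A \<in> sets borel"
  shows "emeasure (hausdorff_measure k) A = hausdorff_outer k A"
proof -
  interpret P: sigma_algebra UNIV "Pow UNIV :: 'a set set" by (rule sigma_algebra_Pow)
  define L where "L = lambda_system UNIV (Pow UNIV) (hausdorff_outer k :: 'a set \<Rightarrow> ennreal)"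
  have ms: "measure_space UNIV L (hausdorff_outer k)"
    unfolding L_def by (rule P.caratheodory_lemma[OF outer_measure_space_hausdorff])
  have "F \<in> L" if "closed F" for F :: "'a set"
    unfolding L_def P.lambda_system_eq
  proof (clarsimp, rule antisym)
    fix x
    show "hausdorff_outer k (x \<inter> F) + hausdorff_outer k (x - F) \<le> hausdorff_outer k x"
      by (rule hausdorff_outer_closed_split[OF that])
    show "hausdorff_outer k x \<le> hausdorff_outer k (x \<inter> F) + hausdorff_outer k (x - F)"
      using hausdorff_outer_Un_le[of k "x \<inter> F" "x - F"] by (simp add: Int_Diff_Un)
  qed
  moreover have "sigma_algebra UNIV L" using ms by (simp add: measure_space_def)
  ultimately have "sigma_sets UNIV (Collect closed) \<subseteq> L"
    by (intro sigma_algebra.sigma_sets_subset) auto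
  then have sub: "sets (borel :: 'a measure) \<subseteq> L"
    by (simp add: borel_eq_closed)
  have "countably_additive (sets borel) (hausdorff_outer k :: 'a set \<Rightarrow> ennreal)"
    using ms sub unfolding measure_space_def countably_additive_def
    by (metis order_trans subset_iff)
  moreover have "positive (sets borel) (hausdorff_outer k :: 'a set \<Rightarrow> ennreal)"
    by (simp add: positive_def)
  moreover have "sigma_algebra UNIV (sets (borel :: 'a measure))"
    using sets.sigma_algebra_axioms[of "borel :: 'a measure"] by simp
  ultimately show ?thesis
    unfolding hausdorff_measure_def using assms by (intro emeasure_measure_of_sigma) auto
qed

section \<open>Estimates for the Hausdorff measure on the sphere\<close>

text \<open>The factor \<open>x - y\<close> is the point: with radii \<open>1 + s/2\<close> and
  \<open>1 - s/2\<close> it makes the volume of a thin annulus of order \<open>s\<close>.\<close>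

lemma power_diff_le:
  fixes x y :: real
  assumes "0 \<le> y" "y \<le> x"
  shows "x ^ n - y ^ n \<le> real n * (x - y) * x ^ (n - 1)"
proof (induction n)
  case (Suc n)
  have "x ^ Suc n - y ^ Suc n = x * (x ^ n - y ^ n) + (x - y) * y ^ n"
    by (simp add: algebra_simps)
  also have "\<dots> \<le> x * (real n * (x - y) * x ^ (n - 1)) + (x - y) * x ^ n"
    using assms by (intro add_mono mult_left_mono Suc.IH power_mono) auto
  also have "\<dots> = real (Suc n) * (x - y) * x ^ (Suc n - 1)"
    by (cases n) (auto simp: algebra_simps)
  finally show ?case .
qed simp

text \<open>Packing by volume: disjoint balls of radius \<open>s/2\<close> around the points lie in
  an annulus of thickness \<open>s\<close>. Each ball has volume of order \<open>s^n\<close>, the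
  annulus only of order \<open>s\<close>, and the quotient leaves the exponent n - 1.\<close>

lemma separated_sphere_card_le:
  fixes F :: "'a::euclidean_space set"
  assumes F: "finite F" "F \<subseteq> sphere 0 1" and s: "0 < s" "s \<le> 1"
    and sep: "\<And>x y. x \<in> F \<Longrightarrow> y \<in> F \<Longrightarrow> x \<noteq> y \<Longrightarrow> s < dist x y"
  shows "real (card F) * s ^ (DIM('a) - 1) \<le> real DIM('a) * 2 ^ (2 * DIM('a))"
proof -
  let ?n = "DIM('a)" and ?w = "unit_ball_vol (real DIM('a))"
  have w: "?w > 0" by simp
  let ?U = "\<Union>x\<in>F. ball x (s/2)"
  have disj: "disjoint_family_on (\<lambda>x. ball x (s/2)) F"
    unfolding disjoint_family_on_def
  proof (intro ballI impI)
    fix x y assume xy: "x \<in> F" "y \<in> F" "x \<noteq> y"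
    show "ball x (s/2) \<inter> ball y (s/2) = {}"
      by (rule disjoint_ballI) (use sep[OF xy] in simp)
  qed
  have "measure lborel ?U = (\<Sum>x\<in>F. measure lborel (ball x (s/2)))"
    by (rule measure_finite_Union[OF F(1) _ disj]) (use emeasure_lborel_ball_finite in \<open>auto simp: less_top\<close>)
  also have "\<dots> = real (card F) * (?w * (s/2) ^ ?n)"
    using s by (simp add: content_ball)
  finally have U: "measure lborel ?U = real (card F) * (?w * (s/2) ^ ?n)" .
  have sub: "?U \<subseteq> cball 0 (1 + s/2) - ball 0 (1 - s/2)"
  proof
    fix y assume "y \<in> ?U"
    then obtain x where x: "x \<in> F" "dist x y < s/2" by auto
    then have "norm x = 1" using F by auto
    then have "norm y < 1 + s/2" "1 - s/2 < norm y"
      using x(2) norm_triangle_ineq2[of y x] norm_triangle_ineq2[of x y] by (auto simp: dist_norm norm_minus_commute)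
    then show "y \<in> cball 0 (1 + s/2) - ball 0 (1 - s/2)" by (auto simp: dist_norm)
  qed
  have "measure lborel ?U \<le> measure lborel (cball (0::'a) (1 + s/2) - ball 0 (1 - s/2))"
    using emeasure_lborel_cball_finite[of "0::'a" "1 + s/2"]
    by (intro measure_mono_fmeasurable[OF sub] fmeasurable.Diff)
       (auto intro!: fmeasurableI borel_open intro: emeasure_lborel_ball_finite[unfolded infinity_ennreal_def])
  also have "\<dots> = measure lborel (cball (0::'a) (1 + s/2)) - measure lborel (ball (0::'a) (1 - s/2))"
    using s emeasure_lborel_cball_finite[of "0::'a" "1 + s/2"]
    by (intro measure_Diff) (auto simp: less_top[symmetric] intro: order_trans[OF ball_subset_cball])
  also have "\<dots> = ?w * ((1 + s/2) ^ ?n - (1 - s/2) ^ ?n)"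
    using s by (simp add: content_ball content_cball algebra_simps)
  also have "\<dots> \<le> ?w * (real ?n * ((1 + s/2) - (1 - s/2)) * (1 + s/2) ^ (?n - 1))"
    using s w by (intro mult_left_mono power_diff_le) auto
  also have "\<dots> = ?w * (real ?n * s * (1 + s/2) ^ (?n - 1))" by simp
  also have "\<dots> \<le> ?w * (real ?n * s * 2 ^ ?n)"
  proof -
    have "(1 + s/2) ^ (?n - 1) \<le> 2 ^ (?n - 1)" using s by (intro power_mono) auto
    also have "\<dots> \<le> (2::real) ^ ?n" by (rule power_increasing) auto
    finally show ?thesis using s w by (intro mult_left_mono) auto
  qed
  finally have "real (card F) * (s/2) ^ ?n \<le> real ?n * s * 2 ^ ?n"
    unfolding U using w by (simp add: algebra_simps)
  moreover have "s ^ ?n = s * s ^ (?n - 1)"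
    using DIM_positive[where 'a='a] by (metis power_eq_if neq0_conv)
  ultimately have "s * (real (card F) * s ^ (?n - 1)) \<le> s * (real ?n * (2 ^ ?n * 2 ^ ?n))"
    by (simp add: power_divide field_simps)
  then have "real (card F) * s ^ (?n - 1) \<le> real ?n * (2 ^ ?n * 2 ^ ?n)"
    using s by simp
  then show ?thesis by (simp add: power_mult power2_eq_square power_mult_distrib mult_2 power_add)
qed

text \<open>A separated set of largest cardinality exists by the packing bound, and it is a net
  because any uncovered point could be added to it.\<close>

lemma sphere_net_exists:
  assumes s: "0 < s" "s \<le> 1"
  obtains F :: "'a::euclidean_space set" where "finite F" "F \<subseteq> sphere 0 1"
    "real (card F) * s ^ (DIM('a) - 1) \<le> real DIM('a) * 2 ^ (2 * DIM('a))"
    "sphere 0 1 \<subseteq> (\<Union>x\<in>F. cball x s)"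
proof -
  define P where "P F \<longleftrightarrow> finite F \<and> F \<subseteq> sphere (0::'a) 1 \<and> (\<forall>x\<in>F. \<forall>y\<in>F. x \<noteq> y \<longrightarrow> s < dist x y)" for F
  define B where "B = nat \<lceil>real DIM('a) * 2 ^ (2 * DIM('a)) / s ^ (DIM('a) - 1)\<rceil>"
  have card: "real (card F) * s ^ (DIM('a) - 1) \<le> real DIM('a) * 2 ^ (2 * DIM('a))" if "P F" for F
    using that by (intro separated_sphere_card_le s) (auto simp: P_def)
  have "card F < Suc B" if "P F" for F
  proof -
    have "real (card F) \<le> real DIM('a) * 2 ^ (2 * DIM('a)) / s ^ (DIM('a) - 1)"
      using card[OF that] s by (simp add: field_simps)
    then show ?thesis unfolding B_def by linarith
  qed
  moreover have "P {}" by (simp add: P_def)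
  ultimately obtain F where F: "P F" and max: "\<And>F'. P F' \<Longrightarrow> card F' \<le> card F"
    using ex_has_greatest_nat[of P "{}" card "Suc B"] by (metis less_imp_le)
  have "sphere 0 1 \<subseteq> (\<Union>x\<in>F. cball x s)"
  proof (rule ccontr)
    assume "\<not> ?thesis"
    then obtain z where z: "z \<in> sphere 0 1" "\<And>x. x \<in> F \<Longrightarrow> s < dist x z" by fastforce
    then have "z \<notin> F" using s by fastforce
    have "P (insert z F)" using F z by (auto simp: P_def dist_commute)
    then show False using max[of "insert z F"] \<open>z \<notin> F\<close> F by (simp add: P_def)
  qed
  then show ?thesis using F card[OF F] by (intro that[of F]) (auto simp: P_def)
qed

lemma hausdorff_outer_sphere_finite:
  "hausdorff_outer (DIM('a::euclidean_space) - 1) (sphere (0::'a) 1) < top"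
proof -
  let ?k = "DIM('a) - 1"
  define c where "c = unit_ball_vol (real ?k) * (real DIM('a) * 2 ^ (2 * DIM('a)))"
  have "hausdorff_premeasure ?k \<delta> (sphere (0::'a) 1) \<le> ennreal c" if "0 < \<delta>" for \<delta>
  proof -
    \<comment> \<open>Balls of radius \<open>s\<close> have diameter \<open>2 * s\<close>, at most
      \<open>\<delta>\<close>. The resulting bound \<open>c\<close> is independent of
      \<open>\<delta>\<close> and therefore survives the supremum over all meshes.\<close>
    define s where "s = min \<delta> 1 / 2"
    have s: "0 < s" "s \<le> 1" "2 * s \<le> \<delta>" using that by (auto simp: s_def)
    obtain F :: "'a set" where F: "finite F" "F \<subseteq> sphere 0 1"
      "real (card F) * s ^ ?k \<le> real DIM('a) * 2 ^ (2 * DIM('a))" "sphere 0 1 \<subseteq> (\<Union>x\<in>F. cball x s)"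
      using sphere_net_exists[OF s(1,2)] by metis
    obtain e where e: "bij_betw e {0..<card F} F" using ex_bij_betw_nat_finite[OF F(1)] by blast
    define C where "C i = (if i < card F then cball (e i) s else {})" for i
    have "(\<Union>x\<in>F. cball x s) \<subseteq> (\<Union>i. C i)"
    proof
      fix y assume "y \<in> (\<Union>x\<in>F. cball x s)"
      then obtain x where x: "x \<in> F" "y \<in> cball x s" by blast
      then have "x \<in> e ` {0..<card F}" using e by (simp add: bij_betw_def)
      then obtain i where "i < card F" "e i = x" by auto
      then have "y \<in> C i" using x by (simp add: C_def)
      then show "y \<in> (\<Union>i. C i)" by blast
    qed
    then have "C \<in> hausdorff_covers \<delta> (sphere 0 1)"
      using F(4) s that unfolding hausdorff_covers_def C_def by (auto simp: diameter_cball)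
    then have "hausdorff_premeasure ?k \<delta> (sphere (0::'a) 1) \<le> (\<Sum>i. hausdorff_weight ?k (C i))"
      by (rule hausdorff_premeasure_le_suminf)
    also have "\<dots> = (\<Sum>i<card F. hausdorff_weight ?k (C i))"
      by (intro suminf_finite) (auto simp: C_def)
    also have "\<dots> = (\<Sum>i<card F. ennreal (unit_ball_vol (real ?k) * s ^ ?k))"
      using s by (intro sum.cong) (auto simp: C_def hausdorff_weight_def diameter_cball)
    also have "\<dots> = ennreal (unit_ball_vol (real ?k) * (real (card F) * s ^ ?k))"
      using s by (simp add: ennreal_of_nat_eq_real_of_nat ennreal_mult[symmetric] mult_ac)
    also have "\<dots> \<le> ennreal c"
      unfolding c_def using F(3) by (intro ennreal_leI mult_left_mono) auto
    finally show ?thesis .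
  qed
  then have "hausdorff_outer ?k (sphere (0::'a) 1) \<le> ennreal c"
    unfolding hausdorff_outer_def by (intro SUP_least) auto
  then show ?thesis by (meson ennreal_less_top le_less_trans)
qed

text \<open>The volume of the shell over a subset of the sphere is compared with the Hausdorff
  measure of the subset; this avoids comparing the Hausdorff measure with a Lebesgue measure
  in dimension \<open>n - 1\<close>.\<close>
definition shell :: "'a::real_vector set \<Rightarrow> 'a set" where
  "shell A = (\<lambda>(t, u). t *\<^sub>R u) ` ({1..2} \<times> A)"

section \<open>Lower bound: caps measured through the volume of shells\<close>

lemma compact_shell: "compact A \<Longrightarrow> compact (shell (A :: 'a::euclidean_space set))"
  unfolding shell_def
  by (intro compact_continuous_image compact_Times) (auto intro!: continuous_intros simp: split_beta)

text \<open>The shell over a set of diameter at most \<open>d\<close> is a tube of length 1 and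
  width of order \<open>d\<close>, so about \<open>1 / d\<close> balls of radius
  \<open>3 * d\<close> along the ray through one of its points cover it. Their total volume is of
  order \<open>d^(n-1)\<close>.\<close>

lemma emeasure_shell_le_diameter:
  fixes C :: "'a::euclidean_space set"
  assumes C: "compact C" "C \<subseteq> sphere 0 1" "C \<noteq> {}" and d: "diameter C \<le> d" "0 < d" "d \<le> 1"
  shows "emeasure lborel (shell C) \<le> ennreal (3 ^ (DIM('a) + 1) * unit_ball_vol (real DIM('a)) * d ^ (DIM('a) - 1))"
proof -
  let ?n = "DIM('a)" and ?w = "unit_ball_vol (real DIM('a))"
  obtain u where u: "u \<in> C" using C by auto
  define m where "m = nat \<lceil>1 / d\<rceil>"
  have m: "real m \<le> 1 / d + 1" "1 / d \<le> real m"
    using d unfolding m_def by (auto simp: of_nat_ceiling)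
  have dd: "dist v v' \<le> d" if "v \<in> C" "v' \<in> C" for v v'
    using diameter_bounded_bound[OF compact_imp_bounded[OF C(1)] that] d by linarith
  have sub: "shell C \<subseteq> (\<Union>j\<in>{..m}. cball ((1 + real j * d) *\<^sub>R u) (3 * d))"
  proof
    fix x assume "x \<in> shell C"
    then obtain t v where tv: "1 \<le> t" "t \<le> 2" "v \<in> C" "x = t *\<^sub>R v" by (auto simp: shell_def)
    define j where "j = nat \<lfloor>(t - 1) / d\<rfloor>"
    have j: "real j \<le> (t - 1) / d" "(t - 1) / d \<le> real j + 1"
      using tv d unfolding j_def by (auto simp: of_nat_floor)
    have "(t - 1) / d \<le> 1 / d" using tv d by (intro divide_right_mono) auto
    with j m have "real j \<le> real m" by linarith
    then have "j \<le> m" by simp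
    have "dist x ((1 + real j * d) *\<^sub>R u) \<le> dist (t *\<^sub>R v) (t *\<^sub>R u) + dist (t *\<^sub>R u) ((1 + real j * d) *\<^sub>R u)"
      unfolding tv by (rule dist_triangle)
    also have "dist (t *\<^sub>R v) (t *\<^sub>R u) = t * dist v u" using tv by (simp add: dist_norm flip: scaleR_diff_right)
    also have "dist (t *\<^sub>R u) ((1 + real j * d) *\<^sub>R u) = \<bar>t - (1 + real j * d)\<bar>"
      using u C by (auto simp: dist_norm simp flip: scaleR_diff_left)
    also have "t * dist v u \<le> 2 * d" using tv dd[OF tv(3) u] d by (intro mult_mono) auto
    also have "\<bar>t - (1 + real j * d)\<bar> \<le> d"
    proof -
      have "real j * d \<le> t - 1" "t - 1 \<le> (real j + 1) * d" using j d by (auto simp: field_simps)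
      then show ?thesis by (auto simp: algebra_simps)
    qed
    \<comment> \<open>The radius \<open>3 * d\<close> is made of \<open>2 * d\<close> for turning
      \<open>v\<close> into \<open>u\<close> at height at most 2, and \<open>d\<close> for rounding
      the height down to the grid.\<close>
    finally have "dist x ((1 + real j * d) *\<^sub>R u) \<le> 3 * d" by simp
    then show "x \<in> (\<Union>j\<in>{..m}. cball ((1 + real j * d) *\<^sub>R u) (3 * d))"
      using \<open>j \<le> m\<close> by (auto simp: dist_commute)
  qed
  have "emeasure lborel (shell C) \<le> emeasure lborel (\<Union>j\<in>{..m}. cball ((1 + real j * d) *\<^sub>R u) (3 * d))"
    by (intro emeasure_mono sub) auto
  also have "\<dots> \<le> (\<Sum>j\<in>{..m}. emeasure lborel (cball ((1 + real j * d) *\<^sub>R u) (3 * d)))"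
    by (intro emeasure_subadditive_finite) auto
  also have "\<dots> = ennreal (real (Suc m) * (?w * (3 * d) ^ ?n))"
    using d by (simp add: emeasure_cball ennreal_of_nat_eq_real_of_nat ennreal_mult[symmetric] del: of_nat_Suc)
  also have "\<dots> \<le> ennreal (3 ^ (?n + 1) * ?w * d ^ (?n - 1))"
  proof (rule ennreal_leI)
    have "real (Suc m) * d \<le> 3"
    proof -
      have "real (Suc m) \<le> 1 / d + 2" using m by simp
      then have "real (Suc m) * d \<le> (1 / d + 2) * d" using d by (intro mult_right_mono) auto
      also have "\<dots> = 1 + 2 * d" using d by (simp add: field_simps)
      finally show ?thesis using d by linarith
    qed
    moreover have "d ^ ?n = d * d ^ (?n - 1)"
      using DIM_positive[where 'a='a] by (metis power_eq_if neq0_conv)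
    ultimately have "real (Suc m) * (?w * (3 * d) ^ ?n) = (real (Suc m) * d) * (?w * 3 ^ ?n * d ^ (?n - 1))"
      by (simp add: power_mult_distrib)
    also have "\<dots> \<le> 3 * (?w * 3 ^ ?n * d ^ (?n - 1))"
      using d \<open>real (Suc m) * d \<le> 3\<close> by (intro mult_right_mono) auto
    finally show "real (Suc m) * (?w * (3 * d) ^ ?n) \<le> 3 ^ (?n + 1) * ?w * d ^ (?n - 1)"
      by (simp add: mult_ac)
  qed
  finally show ?thesis .
qed

text \<open>Quotient of the constant in the tube estimate and the normalisation of the Hausdorff
  weight, in which \<open>d^(n-1)\<close> carries the factor
  \<open>unit_ball_vol (n-1) / 2^(n-1)\<close>.\<close>

definition shell_const :: "nat \<Rightarrow> real" where
  "shell_const n = 3 ^ (n + 1) * unit_ball_vol (real n) * 2 ^ (n - 1) / unit_ball_vol (real (n - 1))"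

lemma shell_const_pos: "shell_const n > 0"
  by (simp add: shell_const_def)

lemma emeasure_shell_le_weight:
  fixes C :: "'a::euclidean_space set"
  assumes C: "compact C" "C \<subseteq> sphere 0 1" and d: "diameter C < 1"
  shows "emeasure lborel (shell C) \<le> ennreal (shell_const DIM('a)) * hausdorff_weight (DIM('a) - 1) C"
proof (cases "C = {}")
  case True
  then show ?thesis by (simp add: shell_def)
next
  case False
  let ?n = "DIM('a)" and ?w = "unit_ball_vol (real DIM('a))"
  have pos: "0 \<le> diameter C" using C by (intro diameter_ge_0 compact_imp_bounded)
  \<comment> \<open>The diameter itself may be 0, as for a single point, while the tube estimate
    asks for a positive width; hence the limit from the right.\<close>
  have "((\<lambda>d. ennreal (3 ^ (?n + 1) * ?w * d ^ (?n - 1))) \<longlongrightarrow> ennreal (3 ^ (?n + 1) * ?w * diameter C ^ (?n - 1)))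
      (at_right (diameter C))"
    by (intro tendsto_intros)
  moreover have "\<forall>\<^sub>F d in at_right (diameter C). emeasure lborel (shell C) \<le> ennreal (3 ^ (?n + 1) * ?w * d ^ (?n - 1))"
    unfolding eventually_at_right_field using d pos
    by (intro exI[of _ 1] conjI allI impI emeasure_shell_le_diameter C False) auto
  ultimately have "emeasure lborel (shell C) \<le> ennreal (3 ^ (?n + 1) * ?w * diameter C ^ (?n - 1))"
    by (rule tendsto_lowerbound) simp
  also have "\<dots> = ennreal (shell_const ?n) * hausdorff_weight (?n - 1) C"
  proof -
    define v where "v = unit_ball_vol (real (?n - 1))"
    have v: "v > 0" unfolding v_def by (rule unit_ball_vol_pos) simp
    show ?thesis
      using v False pos unfolding hausdorff_weight_def shell_const_def v_def[symmetric]
      by (simp add: ennreal_mult[symmetric] field_simps power_divide)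
  qed
  finally show ?thesis .
qed

lemma emeasure_shell_le_hausdorff_outer:
  fixes A :: "'a::euclidean_space set"
  assumes A: "compact A" "A \<subseteq> sphere 0 1"
  shows "emeasure lborel (shell A) \<le> ennreal (shell_const DIM('a)) * hausdorff_outer (DIM('a) - 1) A"
proof -
  let ?k = "DIM('a) - 1"
  have "emeasure lborel (shell A) \<le> ennreal (shell_const DIM('a)) * hausdorff_premeasure ?k (1/2) A"
  proof -
    \<comment> \<open>With the constant divided out, the bare infimum stands on the right and can be
      tested cover by cover.\<close>
    have "emeasure lborel (shell A) / ennreal (shell_const DIM('a)) \<le> hausdorff_premeasure ?k (1/2) A"
      unfolding hausdorff_premeasure_eq
    proof (rule INF_greatest)
      fix C assume C: "C \<in> hausdorff_covers (1/2) A"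
      \<comment> \<open>Covering sets are arbitrary. Closing them and cutting with the sphere gives
        compact sets, whose shells are measurable, and does not increase the diameter.\<close>
      define E where "E i = closure (C i) \<inter> sphere 0 1" for i
      have bd: "bounded (C i)" and di: "diameter (C i) \<le> 1/2" for i
        using C by (auto simp: hausdorff_covers_def)
      have E: "compact (E i)" "E i \<subseteq> sphere 0 1" "diameter (E i) \<le> diameter (C i)" for i
        unfolding E_def using bd[of i] diameter_subset[of "closure (C i) \<inter> sphere 0 1" "closure (C i)"]
        by (auto intro: closed_Int_compact simp: diameter_closure)
      have "shell A \<subseteq> (\<Union>i. shell (E i))"
      proof
        fix x assume "x \<in> shell A"
        then obtain t u where tu: "t \<in> {1..2}" "u \<in> A" "x = t *\<^sub>R u" by (auto simp: shell_def)
        have "A \<subseteq> (\<Union>i. C i)" using C by (simp add: hausdorff_covers_def)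
        then obtain i where "u \<in> C i" using tu by blast
        then have "u \<in> E i" using tu A closure_subset by (auto simp: E_def)
        then have "x \<in> shell (E i)" using tu unfolding shell_def by force
        then show "x \<in> (\<Union>i. shell (E i))" by blast
      qed
      then have "emeasure lborel (shell A) \<le> emeasure lborel (\<Union>i. shell (E i))"
        using compact_shell[OF E(1)] by (intro emeasure_mono) (auto intro: borel_compact)
      also have "\<dots> \<le> (\<Sum>i. emeasure lborel (shell (E i)))"
        using compact_shell[OF E(1)] by (intro emeasure_subadditive_countably) (auto intro: borel_compact)
      also have "\<dots> \<le> (\<Sum>i. ennreal (shell_const DIM('a)) * hausdorff_weight ?k (C i))"
      proof (intro suminf_le)
        fix i
        have "emeasure lborel (shell (E i)) \<le> ennreal (shell_const DIM('a)) * hausdorff_weight ?k (E i)"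
          using E[of i] di[of i] by (intro emeasure_shell_le_weight) auto
        also have "hausdorff_weight ?k (E i) \<le> hausdorff_weight ?k (C i)"
        proof (cases "C i = {}")
          case False
          have "0 \<le> diameter (E i)" using E by (intro diameter_ge_0 compact_imp_bounded)
          then show ?thesis using False E(3)[of i]
            by (auto simp: hausdorff_weight_def intro!: ennreal_leI mult_left_mono power_mono)
        qed (simp add: E_def)
        finally show "emeasure lborel (shell (E i)) \<le> ennreal (shell_const DIM('a)) * hausdorff_weight ?k (C i)"
          by (simp add: mult_left_mono)
      qed auto
      also have "\<dots> = (\<Sum>i. hausdorff_weight ?k (C i)) * ennreal (shell_const DIM('a))"
        by (simp add: mult.commute)
      finally show "emeasure lborel (shell A) / ennreal (shell_const DIM('a)) \<le> (\<Sum>i. hausdorff_weight ?k (C i))"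
        using shell_const_pos[of "DIM('a)"] by (intro divide_le_posI_ennreal) (simp_all add: mult.commute)
    qed
    then have "ennreal (shell_const DIM('a)) * (emeasure lborel (shell A) / ennreal (shell_const DIM('a)))
        \<le> ennreal (shell_const DIM('a)) * hausdorff_premeasure ?k (1/2) A"
      by (rule mult_left_mono) simp
    then show ?thesis
      using shell_const_pos[of "DIM('a)"]
      by (simp add: ennreal_times_divide mult_divide_eq_ennreal mult.commute[of _ "emeasure lborel (shell A)"])
  qed
  also have "\<dots> \<le> ennreal (shell_const DIM('a)) * hausdorff_outer ?k A"
    by (intro mult_left_mono hausdorff_premeasure_le_outer) auto
  finally show ?thesis .
qed

text \<open>The shell over the cap contains N - 1 disjoint balls of radius 1/(4N) strung along the
  ray through \<open>w\<close>. The factor 2 in the constant comes from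
  \<open>N - 1 \<ge> N / 2\<close>, the factor \<open>4 ^ n\<close> from the radius.\<close>

lemma emeasure_shell_cap_ge:
  fixes w :: "'a::euclidean_space"
  assumes w: "norm w = 1" and N: "2 \<le> N"
  shows "ennreal (unit_ball_vol (real DIM('a)) / (2 * 4 ^ DIM('a)) / real N ^ (DIM('a) - 1))
    \<le> emeasure lborel (shell (sphere 0 1 \<inter> cball w (1 / real N)))"
proof -
  let ?n = "DIM('a)" and ?v = "unit_ball_vol (real DIM('a))" and ?A = "sphere 0 1 \<inter> cball w (1 / real N)"
  define B where "B j = ball ((1 + real j / real N) *\<^sub>R w) (1 / (4 * real N))" for j
  have N0: "0 < real N" using N by simp
  have disj: "disjoint_family_on B {1..<N}"
    unfolding disjoint_family_on_def B_def
  proof (intro ballI impI disjoint_ballI)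
    fix i j :: nat assume "i \<noteq> j"
    then have "1 \<le> \<bar>real i - real j\<bar>" by linarith
    then have "1 / real N \<le> \<bar>real i - real j\<bar> / real N" by (rule divide_right_mono) simp
    also have "\<dots> = dist ((1 + real i / real N) *\<^sub>R w) ((1 + real j / real N) *\<^sub>R w)"
      using w N0 by (simp add: dist_norm flip: scaleR_diff_left diff_divide_distrib)
    finally show "1 / (4 * real N) + 1 / (4 * real N) \<le> dist ((1 + real i / real N) *\<^sub>R w) ((1 + real j / real N) *\<^sub>R w)"
      using N0 by (simp add: field_simps)
  qed
  have sub: "(\<Union>j\<in>{1..<N}. B j) \<subseteq> shell ?A"
  proof
    fix x assume "x \<in> (\<Union>j\<in>{1..<N}. B j)"
    then obtain j where j: "1 \<le> j" "j < N" "x \<in> B j" by auto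
    define t where "t = 1 + real j / real N"
    have xt: "norm (x - t *\<^sub>R w) < 1 / (4 * real N)" using j by (simp add: B_def t_def dist_norm norm_minus_commute)
    have "1 / real N \<le> real j / real N" "real j / real N \<le> (real N - 1) / real N"
      using j by (auto intro!: divide_right_mono)
    then have t: "1 + 1 / real N \<le> t" "t \<le> 2 - 1 / real N"
      unfolding t_def using N0 by (auto simp: diff_divide_distrib)
    have nt: "norm (t *\<^sub>R w) = t" using w t N0 by (auto simp: t_def)
    have dn: "\<bar>norm x - t\<bar> \<le> norm (x - t *\<^sub>R w)" using norm_triangle_ineq3[of x "t *\<^sub>R w"] nt by simp
    have q: "1 / (4 * real N) \<le> 1 / real N" using N0 by (simp add: field_simps)
    have nx: "1 \<le> norm x" "norm x \<le> 2" using dn xt t q by linarith+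
    define u where "u = x /\<^sub>R norm x"
    have u: "norm u = 1" "x = norm x *\<^sub>R u" using nx by (auto simp: u_def divide_simps)
    \<comment> \<open>The direction of \<open>x\<close> deviates from \<open>w\<close> by two errors
      of at most 1/(4N) each: the distance of \<open>x\<close> from the ball's centre, and the
      difference between \<open>norm x\<close> and the height \<open>t\<close> of that
      centre.\<close>
    have "norm (norm x *\<^sub>R (u - w)) = norm ((x - t *\<^sub>R w) + (t - norm x) *\<^sub>R w)"
      using u(2) by (simp add: algebra_simps)
    also have "\<dots> \<le> norm (x - t *\<^sub>R w) + \<bar>norm x - t\<bar>"
      using norm_triangle_ineq[of "x - t *\<^sub>R w" "(t - norm x) *\<^sub>R w"] w by (simp add: abs_minus_commute)
    also have "\<dots> \<le> 1 / (4 * real N) + 1 / (4 * real N)" using dn xt by linarith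
    also have "\<dots> \<le> 1 / real N" using N0 by (simp add: field_simps)
    finally have "norm x * norm (u - w) \<le> 1 / real N" by simp
    moreover have "1 * norm (u - w) \<le> norm x * norm (u - w)" using nx by (intro mult_right_mono) auto
    ultimately have "u \<in> ?A" using u by (simp add: dist_norm norm_minus_commute)
    then show "x \<in> shell ?A" unfolding shell_def using nx u(2)
      by (intro image_eqI[of _ _ "(norm x, u)"]) auto
  qed
  have "real (N - 1) \<ge> real N / 2" using N by (auto simp: of_nat_diff)
  have "?v / (2 * 4 ^ ?n) / real N ^ (?n - 1) = real N / 2 * (?v * (1 / (4 * real N)) ^ ?n)"
  proof -
    have "real N ^ ?n = real N * real N ^ (?n - 1)"
      using DIM_positive[where 'a='a] by (metis power_eq_if neq0_conv)
    then show ?thesis using N0 by (simp add: power_divide power_mult_distrib)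
  qed
  also have "\<dots> \<le> real (N - 1) * (?v * (1 / (4 * real N)) ^ ?n)"
    using \<open>real (N - 1) \<ge> real N / 2\<close> by (rule mult_right_mono) simp
  finally have "ennreal (?v / (2 * 4 ^ ?n) / real N ^ (?n - 1)) \<le> ennreal (real (N - 1) * (?v * (1 / (4 * real N)) ^ ?n))"
    by (rule ennreal_leI)
  also have "\<dots> = (\<Sum>j\<in>{1..<N}. emeasure lborel (B j))"
    by (simp add: B_def emeasure_ball ennreal_of_nat_eq_real_of_nat ennreal_mult)
  also have "\<dots> = emeasure lborel (\<Union>j\<in>{1..<N}. B j)"
    by (rule sum_emeasure[OF _ disj]) (auto simp: B_def)
  also have "\<dots> \<le> emeasure lborel (shell ?A)"
    using borel_compact[OF compact_shell[OF compact_Int_closed[OF compact_sphere closed_cball]]]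
    by (intro emeasure_mono sub) simp
  finally show ?thesis .
qed

section \<open>The spherical measure\<close>

lemma space_spherical_measure [simp]: "space (spherical_measure :: 'a::euclidean_space measure) = sphere 0 1"
  by (simp add: spherical_measure_def space_restrict_space)

lemma sets_spherical_measure:
  "sets (spherical_measure :: 'a::euclidean_space measure) = sets (restrict_space borel (sphere 0 1))"
  by (simp add: spherical_measure_def sets_restrict_space)

lemma borel_measurable_on_sphere:
  assumes "sets M = sets (restrict_space borel (sphere (0::'a::euclidean_space) 1))"
    and "continuous_on (sphere 0 1) f"
  shows "f \<in> borel_measurable M"
  using borel_measurable_continuous_on_restrict[OF assms(2)] measurable_cong_sets[OF assms(1) refl] by blast

lemma sets_sphere_Int:
  assumes "sets M = sets (restrict_space borel (sphere (0::'a::euclidean_space) 1))" and "B \<in> sets borel"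
  shows "sphere 0 1 \<inter> B \<in> sets M"
  using assms by (auto simp: sets_restrict_space)

lemma emeasure_spherical_measure:
  fixes B :: "'a::euclidean_space set"
  assumes "B \<in> sets borel" "B \<subseteq> sphere 0 1"
  shows "emeasure spherical_measure B = hausdorff_outer (DIM('a) - 1) B"
  using assms by (simp add: spherical_measure_def emeasure_restrict_space emeasure_hausdorff_measure)

lemma finite_measure_spherical_measure:
  "finite_measure (spherical_measure :: 'a::euclidean_space measure)"
proof (rule finite_measureI)
  show "emeasure (spherical_measure :: 'a measure) (space spherical_measure) \<noteq> \<infinity>"
    using hausdorff_outer_sphere_finite[where 'a='a]
    by (simp add: emeasure_spherical_measure)
qed

definition cap_const :: "nat \<Rightarrow> real" where
  "cap_const n = unit_ball_vol (real n) / (2 * 4 ^ n) / shell_const n"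

lemma cap_const_pos: "cap_const n > 0"
  using shell_const_pos[of n] by (simp add: cap_const_def)

lemma emeasure_cap_ge:
  fixes w :: "'a::euclidean_space"
  assumes w: "norm w = 1" and N: "2 \<le> N"
  shows "ennreal (cap_const DIM('a) / real N ^ (DIM('a) - 1)) \<le> emeasure spherical_measure (sphere 0 1 \<inter> cball w (1 / real N))"
proof -
  let ?A = "sphere 0 1 \<inter> cball w (1 / real N)" and ?s = "shell_const DIM('a)"
  have c: "compact ?A" by (intro compact_Int_closed) auto
  have s: "?s > 0" by (rule shell_const_pos)
  have "ennreal (?s * (cap_const DIM('a) / real N ^ (DIM('a) - 1))) \<le> emeasure lborel (shell ?A)"
    using emeasure_shell_cap_ge[OF assms] s by (simp add: cap_const_def field_simps)
  also have "\<dots> \<le> ennreal ?s * hausdorff_outer (DIM('a) - 1) ?A"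
    by (rule emeasure_shell_le_hausdorff_outer[OF c]) auto
  also have "hausdorff_outer (DIM('a) - 1) ?A = emeasure spherical_measure ?A"
    using borel_compact[OF c] by (intro emeasure_spherical_measure[symmetric]) auto
  finally have "ennreal ?s * ennreal (cap_const DIM('a) / real N ^ (DIM('a) - 1)) \<le> ennreal ?s * emeasure spherical_measure ?A"
    using s cap_const_pos[of "DIM('a)"] by (subst ennreal_mult[symmetric]) auto
  then show ?thesis
    using s by (simp add: ennreal_mult_le_mult_iff)
qed

text \<open>Used to turn a strict inequality of continuous functions at one point into a strict
  inequality of their integrals.\<close>

lemma emeasure_spherical_open_pos:
  fixes w :: "'a::euclidean_space"
  assumes "open U" "w \<in> U" "norm w = 1"
  shows "0 < emeasure spherical_measure (sphere 0 1 \<inter> U)"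
proof -
  obtain r where r: "0 < r" "cball w r \<subseteq> U" using assms open_contains_cball by blast
  obtain N where N: "2 \<le> N" "1 / real N \<le> r"
  proof -
    obtain m where "1 / r < real m" using reals_Archimedean2 by blast
    then have "1 / r < real (max m 2)" by linarith
    then have "1 / real (max m 2) \<le> r" using r by (simp add: field_simps del: of_nat_max)
    then show ?thesis using that[of "max m 2"] by auto
  qed
  have "0 < ennreal (cap_const DIM('a) / real N ^ (DIM('a) - 1))"
    using cap_const_pos[of "DIM('a)"] N by simp
  also have "\<dots> \<le> emeasure spherical_measure (sphere 0 1 \<inter> cball w (1 / real N))"
    by (rule emeasure_cap_ge[OF assms(3) N(1)])
  also have "\<dots> \<le> emeasure spherical_measure (sphere 0 1 \<inter> U)"
    using r N assms(1) by (intro emeasure_mono sets_sphere_Int[OF sets_spherical_measure] borel_open)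
      (auto simp: mem_cball)
  finally show ?thesis .
qed

text \<open>In dimension at least 2 the sphere is connected, and the distance from \<open>v\<close>
  takes the values 0 at \<open>v\<close> and 2 at \<open>- v\<close>, hence everything in
  between.\<close>

lemma sphere_point_at_distance:
  fixes v :: "'a::euclidean_space"
  assumes "2 \<le> DIM('a)" "norm v = 1" "0 \<le> r" "r \<le> 2"
  obtains w where "norm w = 1" "dist v w = r"
proof -
  have "connected ((\<lambda>w. dist v w) ` sphere 0 1)"
    by (intro connected_continuous_image connected_sphere continuous_intros assms)
  moreover have "0 \<in> (\<lambda>w. dist v w) ` sphere 0 1" using assms by (intro image_eqI[of _ _ v]) auto
  moreover have "2 \<in> (\<lambda>w. dist v w) ` sphere 0 1"
  proof (rule image_eqI[of _ _ "-v"])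
    show "2 = dist v (- v)" using assms norm_scaleR[of 2 v] by (simp add: dist_norm scaleR_2)
  qed (use assms in auto)
  ultimately have "r \<in> (\<lambda>w. dist v w) ` sphere 0 1"
    using assms unfolding connected_iff_interval by blast
  then show ?thesis using that by auto
qed

text \<open>The singularity \<open>\<bar>u - v\<bar>\<close> to the power \<open>-(n - 1)\<close> is critical on the sphere: every dyadic annulus
  around \<open>v\<close> contributes at least a fixed amount to the integral.\<close>
lemma nn_integral_singularity_eq_top:
  fixes v :: "'a::euclidean_space" and f :: "'a \<Rightarrow> ennreal"
  assumes dim: "2 \<le> DIM('a)" and v: "norm v = 1" and f: "f \<in> borel_measurable spherical_measure"
    and c: "0 < c" and r: "0 < r"
    and lower: "\<And>u. norm u = 1 \<Longrightarrow> 0 < dist v u \<Longrightarrow> dist v u < r \<Longrightarrow> ennreal (c / dist v u ^ (DIM('a) - 1)) \<le> f u"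
  shows "(\<integral>\<^sup>+u. f u \<partial>spherical_measure) = top"
proof -
  let ?k = "DIM('a) - 1" and ?S = "spherical_measure :: 'a measure"
  define E where "E p = sphere 0 1 \<inter> {u. 1 / 2 ^ Suc p < dist v u \<and> dist v u < 1 / 2 ^ p}" for p :: nat
  have E_sets: "E p \<in> sets ?S" for p
    unfolding E_def
    by (intro sets_sphere_Int[OF sets_spherical_measure] borel_open open_Collect_conj open_Collect_less continuous_intros)
  \<comment> \<open>Product of the value \<open>c / \<epsilon>^(n-1)\<close> of the lower bound on
    the annulus and the measure bound for a cap of radius \<open>\<epsilon> / 8\<close>; the powers
    of \<open>\<epsilon>\<close> cancel, so \<open>K\<close> is the same for every annulus.\<close>
  define K where "K = c * (cap_const DIM('a) / 8 ^ ?k)"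
  have K: "K > 0" unfolding K_def using c cap_const_pos[of "DIM('a)"] by simp
  obtain p0 :: nat where p0: "1 / 2 ^ p0 < r"
    using real_arch_pow_inv[OF r, of "1/2"] by (auto simp: power_divide)
  have E_le: "1 / 2 ^ p \<le> (1 :: real) / 2 ^ q" if "q \<le> p" for p q :: nat
    using that by (intro divide_left_mono power_increasing) auto
  have annulus: "ennreal K \<le> (\<integral>\<^sup>+u. f u * indicator (E p) u \<partial>?S)" if p: "p0 \<le> p" for p
  proof -
    define \<epsilon> where "\<epsilon> = (1::real) / 2 ^ p"
    have \<epsilon>: "0 < \<epsilon>" "\<epsilon> \<le> 1" "1 / 2 ^ Suc p = \<epsilon> / 2" "1 / real (2 ^ (p + 3)) = \<epsilon> / 8"
      by (auto simp: \<epsilon>_def power_add)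
    \<comment> \<open>A cap of radius \<open>\<epsilon> / 8\<close> centred in the middle of the
      annulus, at distance \<open>3/4 * \<epsilon>\<close> from \<open>v\<close>, stays strictly
      between \<open>\<epsilon> / 2\<close> and \<open>\<epsilon>\<close>.\<close>
    obtain w where w: "norm w = 1" "dist v w = 3/4 * \<epsilon>"
      using sphere_point_at_distance[OF dim v, of "3/4 * \<epsilon>"] \<epsilon> by auto
    have "sphere 0 1 \<inter> cball w (1 / real (2 ^ (p + 3))) \<subseteq> E p"
    proof
      fix u assume u: "u \<in> sphere 0 1 \<inter> cball w (1 / real (2 ^ (p + 3)))"
      then have "dist w u \<le> \<epsilon> / 8" unfolding \<epsilon>(4) by simp
      then have "\<bar>dist v u - 3/4 * \<epsilon>\<bar> \<le> \<epsilon> / 8"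
        using dist_triangle[of v u w] dist_triangle[of v w u] w(2) dist_commute[of u w] unfolding abs_le_iff by linarith
      then have "\<epsilon> / 2 < dist v u" "dist v u < \<epsilon>" using \<epsilon>(1) by linarith+
      then show "u \<in> E p" using u unfolding E_def \<epsilon>(3)[symmetric] by (simp add: \<epsilon>_def)
    qed
    then have "emeasure ?S (sphere 0 1 \<inter> cball w (1 / real (2 ^ (p + 3)))) \<le> emeasure ?S (E p)"
      by (intro emeasure_mono E_sets)
    moreover have "(2::nat) \<le> 2 ^ (p + 3)" by (rule self_le_power) auto
    ultimately have m: "ennreal (cap_const DIM('a) / real (2 ^ (p + 3)) ^ ?k) \<le> emeasure ?S (E p)"
      using emeasure_cap_ge[OF w(1)] order_trans by blast
    have "ennreal K = ennreal (c / \<epsilon> ^ ?k) * ennreal (cap_const DIM('a) / real (2 ^ (p + 3)) ^ ?k)"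
      using c \<epsilon>(1) cap_const_pos[of "DIM('a)"]
      by (simp add: ennreal_mult[symmetric] K_def \<epsilon>_def power_add power_mult_distrib power_divide)
    also have "\<dots> \<le> ennreal (c / \<epsilon> ^ ?k) * emeasure ?S (E p)"
      by (intro mult_left_mono m) simp
    also have "\<dots> = (\<integral>\<^sup>+u. ennreal (c / \<epsilon> ^ ?k) * indicator (E p) u \<partial>?S)"
      using E_sets by (simp add: nn_integral_cmult_indicator)
    also have "\<dots> \<le> (\<integral>\<^sup>+u. f u * indicator (E p) u \<partial>?S)"
    proof (intro nn_integral_mono)
      fix u
      show "ennreal (c / \<epsilon> ^ ?k) * indicator (E p) u \<le> f u * indicator (E p) u"
      proof (cases "u \<in> E p")
        case True
        then have u: "norm u = 1" "\<epsilon> / 2 < dist v u" "dist v u < \<epsilon>" unfolding E_def \<epsilon>(3) by (auto simp: \<epsilon>_def)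
        have "\<epsilon> < r" using E_le[OF p] p0 by (simp add: \<epsilon>_def)
        have "c / \<epsilon> ^ ?k \<le> c / dist v u ^ ?k"
          using u \<epsilon>(1) c by (intro divide_left_mono power_mono mult_pos_pos zero_less_power) auto
        then have "ennreal (c / \<epsilon> ^ ?k) \<le> ennreal (c / dist v u ^ ?k)" by (rule ennreal_leI)
        also have "\<dots> \<le> f u" using u \<epsilon>(1) \<open>\<epsilon> < r\<close> by (intro lower) auto
        finally show ?thesis using True by simp
      qed simp
    qed
    finally show ?thesis .
  qed
  have disj: "disjoint_family E"
    unfolding disjoint_family_on_def
  proof (intro ballI impI)
    fix p q :: nat assume "p \<noteq> q"
    then have "Suc p \<le> q \<or> Suc q \<le> p" by linarith
    then show "E p \<inter> E q = {}" using E_le[of "Suc p" q] E_le[of "Suc q" p] by (auto simp: E_def)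
  qed
  have le: "of_nat N * ennreal K \<le> (\<integral>\<^sup>+u. f u \<partial>?S)" for N
  proof -
    have "of_nat N * ennreal K = (\<Sum>p\<in>{p0..<p0+N}. ennreal K)" by simp
    also have "\<dots> \<le> (\<Sum>p\<in>{p0..<p0+N}. \<integral>\<^sup>+u. f u * indicator (E p) u \<partial>?S)"
      by (intro sum_mono annulus) auto
    also have "\<dots> = (\<integral>\<^sup>+u. (\<Sum>p\<in>{p0..<p0+N}. f u * indicator (E p) u) \<partial>?S)"
      using f E_sets by (intro nn_integral_sum[symmetric]) auto
    also have "\<dots> \<le> (\<integral>\<^sup>+u. f u \<partial>?S)"
    proof (intro nn_integral_mono)
      fix u
      have "(\<Sum>p\<in>{p0..<p0+N}. f u * indicator (E p) u) = f u * (\<Sum>p\<in>{p0..<p0+N}. indicator (E p) u)"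
        by (simp add: sum_distrib_left)
      also have "(\<Sum>p\<in>{p0..<p0+N}. indicator (E p) u :: ennreal) = indicator (\<Union>p\<in>{p0..<p0+N}. E p) u"
        by (rule indicator_UN_disjoint[symmetric]) (auto intro: disjoint_family_on_mono[OF _ disj])
      also have "f u * \<dots> \<le> f u" by (auto simp: indicator_def)
      finally show "(\<Sum>p\<in>{p0..<p0+N}. f u * indicator (E p) u) \<le> f u" .
    qed
    finally show ?thesis .
  qed
  show ?thesis
  proof (rule ccontr)
    assume "\<not> ?thesis"
    then obtain x where x: "(\<integral>\<^sup>+u. f u \<partial>?S) = ennreal x" "0 \<le> x"
      by (cases "(\<integral>\<^sup>+u. f u \<partial>?S)") auto
    obtain N where "x / K < real N" using reals_Archimedean2 by blast
    then have "x < real N * K" using K by (simp add: field_simps)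
    moreover have "ennreal (real N * K) \<le> ennreal x"
      using le[of N] K unfolding x by (simp add: ennreal_of_nat_eq_real_of_nat ennreal_mult)
    ultimately show False using x by simp
  qed
qed

section \<open>Convex bodies and positive sublinear functions\<close>

definition positive_sublinear :: "('a::real_normed_vector \<Rightarrow> real) \<Rightarrow> bool" where
  "positive_sublinear h \<longleftrightarrow> (\<forall>u v. h (u + v) \<le> h u + h v) \<and> (\<forall>c u. 0 \<le> c \<longrightarrow> h (c *\<^sub>R u) = c * h u) \<and>
     (\<forall>u. u \<noteq> 0 \<longrightarrow> 0 < h u)"

lemma positive_sublinearD:
  assumes "positive_sublinear h"
  shows "h (u + v) \<le> h u + h v" "0 \<le> c \<Longrightarrow> h (c *\<^sub>R u) = c * h u" "u \<noteq> 0 \<Longrightarrow> 0 < h u"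
  using assms by (auto simp: positive_sublinear_def)

lemma positive_sublinear_zero: "positive_sublinear h \<Longrightarrow> h 0 = 0"
  using positive_sublinearD(2)[of h 0 0] by simp

lemma positive_sublinear_scale:
  assumes "positive_sublinear h" "0 < c"
  shows "positive_sublinear (\<lambda>u. c * h u)"
  unfolding positive_sublinear_def
proof (intro conjI allI impI)
  fix u v
  show "c * h (u + v) \<le> c * h u + c * h v"
    using mult_left_mono[OF positive_sublinearD(1)[OF assms(1), of u v], of c] assms(2) by (simp add: distrib_left)
qed (use assms in \<open>auto simp: positive_sublinear_def\<close>)

lemma positive_sublinear_add:
  assumes "positive_sublinear h" "positive_sublinear h'"
  shows "positive_sublinear (\<lambda>u. h u + h' u)"
  unfolding positive_sublinear_def
proof (intro conjI allI impI)
  fix u v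
  show "h (u + v) + h' (u + v) \<le> h u + h' u + (h v + h' v)"
    using positive_sublinearD(1)[OF assms(1), of u v] positive_sublinearD(1)[OF assms(2), of u v] by linarith
qed (use assms in \<open>auto simp: positive_sublinear_def distrib_left add_pos_pos\<close>)

lemma positive_sublinear_continuous:
  fixes h :: "'a::euclidean_space \<Rightarrow> real"
  assumes "positive_sublinear h"
  shows "continuous_on S h"
proof -
  have "convex_on UNIV h"
  proof (rule convex_onI)
    fix t x y assume "0 < (t::real)" "t < 1"
    then show "h ((1 - t) *\<^sub>R x + t *\<^sub>R y) \<le> (1 - t) * h x + t * h y"
      using positive_sublinearD(1)[OF assms, of "(1 - t) *\<^sub>R x" "t *\<^sub>R y"] positive_sublinearD(2)[OF assms]
      by simp
  qed simp
  then have "continuous_on UNIV h" by (rule convex_on_continuous[OF open_UNIV])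
  then show ?thesis by (rule continuous_on_subset) simp
qed

lemma positive_sublinear_norm: "positive_sublinear (norm :: 'a::real_normed_vector \<Rightarrow> real)"
  by (auto simp: positive_sublinear_def norm_triangle_ineq)

lemma positive_sublinear_bounds:
  fixes h :: "'a::euclidean_space \<Rightarrow> real"
  assumes h: "positive_sublinear h"
  obtains e R where "0 < e" "0 < R" "\<And>u. e * norm u \<le> h u" "\<And>u. h u \<le> R * norm u"
proof -
  have ne: "sphere (0::'a) 1 \<noteq> {}" by simp
  have cont: "continuous_on (sphere 0 1) h" by (rule positive_sublinear_continuous[OF h])
  obtain a where a: "a \<in> sphere 0 1" "\<And>u. u \<in> sphere 0 1 \<Longrightarrow> h a \<le> h u"
    using continuous_attains_inf[OF compact_sphere ne cont] by blast
  obtain b where b: "b \<in> sphere 0 1" "\<And>u. u \<in> sphere 0 1 \<Longrightarrow> h u \<le> h b"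
    using continuous_attains_sup[OF compact_sphere ne cont] by blast
  have norm_mult: "h u = norm u * h (u /\<^sub>R norm u)" if "u \<noteq> 0" for u
    using that positive_sublinearD(2)[OF h, of "norm u" "u /\<^sub>R norm u"] by simp
  have "h a * norm u \<le> h u \<and> h u \<le> h b * norm u" for u
  proof (cases "u = 0")
    case False
    then have "u /\<^sub>R norm u \<in> sphere 0 1" by simp
    then show ?thesis using a(2) b(2) norm_mult[OF False] by (simp add: mult.commute mult_left_mono)
  qed (simp add: positive_sublinear_zero[OF h])
  moreover have "0 < h a" "0 < h b" using a b by (auto intro!: positive_sublinearD(3)[OF h])
  ultimately show ?thesis using that by blast
qed

section \<open>Support functions of bodies with the origin inside\<close>

lemma inner_le_support_fun:
  fixes Q :: "'a::euclidean_space set"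
  assumes "bounded Q" "x \<in> Q"
  shows "x \<bullet> u \<le> support_fun Q u"
  unfolding support_fun_def
proof (rule cSUP_upper[OF assms(2)])
  obtain B where "\<And>x. x \<in> Q \<Longrightarrow> norm x \<le> B" using assms(1) bounded_iff by blast
  then have "x \<bullet> u \<le> B * norm u" if "x \<in> Q" for x
    using that norm_cauchy_schwarz[of x u] mult_right_mono[of "norm x" B "norm u"] by fastforce
  then show "bdd_above ((\<lambda>x. x \<bullet> u) ` Q)" by (auto simp: bdd_above_def)
qed

lemma support_fun_le:
  assumes "Q \<noteq> {}" "\<And>x. x \<in> Q \<Longrightarrow> x \<bullet> u \<le> b"
  shows "support_fun Q u \<le> b"
  unfolding support_fun_def using assms by (rule cSUP_least)

lemma convex_bodies_oD:
  assumes "Q \<in> convex_bodies_o"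
  shows "compact Q" "convex Q" "bounded Q" "closed Q" "0 \<in> Q" "Q \<noteq> {}"
  using assms interior_subset[of Q]
  by (auto simp: convex_bodies_o_def compact_imp_bounded compact_imp_closed)

lemma positive_sublinear_support_fun:
  assumes Q: "Q \<in> convex_bodies_o"
  shows "positive_sublinear (support_fun Q)"
  unfolding positive_sublinear_def
proof (intro conjI allI impI)
  note [simp] = convex_bodies_oD[OF Q]
  have up: "x \<bullet> u \<le> support_fun Q u" if "x \<in> Q" for x u
    using that by (intro inner_le_support_fun) auto
  show "support_fun Q (u + v) \<le> support_fun Q u + support_fun Q v" for u v
    by (rule support_fun_le) (auto simp: inner_add_right intro: add_mono up)
  have le: "support_fun Q (c *\<^sub>R u) \<le> c * support_fun Q u" if "0 \<le> c" for c u
    by (rule support_fun_le) (auto intro!: mult_left_mono up that)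
  show "support_fun Q (c *\<^sub>R u) = c * support_fun Q u" if "0 \<le> c" for c u
  proof (cases "c = 0")
    case True
    have "support_fun Q 0 = 0" by (simp add: support_fun_def)
    then show ?thesis using True by simp
  next
    case False
    then have "support_fun Q ((1 / c) *\<^sub>R (c *\<^sub>R u)) \<le> (1 / c) * support_fun Q (c *\<^sub>R u)"
      using that by (intro le) auto
    then have "c * support_fun Q u \<le> support_fun Q (c *\<^sub>R u)"
      using False that by (simp add: field_simps)
    with le[OF that, of u] show ?thesis by linarith
  qed
  show "0 < support_fun Q u" if "u \<noteq> 0" for u
  proof -
    have "0 \<in> interior Q" using Q by (simp add: convex_bodies_o_def)
    then obtain e where e: "0 < e" "cball 0 e \<subseteq> Q" by (meson mem_interior_cball)
    have "(e / norm u) *\<^sub>R u \<in> cball 0 e" using e that by simp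
    then have "((e / norm u) *\<^sub>R u) \<bullet> u \<le> support_fun Q u" using e by (intro up) auto
    moreover have "0 < ((e / norm u) *\<^sub>R u) \<bullet> u" using e that by simp
    ultimately show ?thesis by linarith
  qed
qed

lemma convex_body_eq_support_halfspaces:
  assumes Q: "Q \<in> convex_bodies_o"
  shows "Q = {x. \<forall>u. x \<bullet> u \<le> support_fun Q u}"
proof (intro equalityI subsetI)
  note body = convex_bodies_oD[OF Q]
  show "x \<in> {x. \<forall>u. x \<bullet> u \<le> support_fun Q u}" if "x \<in> Q" for x
    using that body inner_le_support_fun by blast
  fix x assume x: "x \<in> {x. \<forall>u. x \<bullet> u \<le> support_fun Q u}"
  show "x \<in> Q"
  proof (rule ccontr)
    assume "x \<notin> Q"
    then obtain a b where ab: "a \<bullet> x < b" "\<forall>y\<in>Q. a \<bullet> y > b"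
      using separating_hyperplane_closed_point[OF body(2,4)] by blast
    \<comment> \<open>The separation puts \<open>Q\<close> on the larger side of \<open>a\<close>,
      so the inequality that \<open>x\<close> violates is the one in direction
      \<open>- a\<close>.\<close>
    have "support_fun Q (- a) \<le> - b"
      using ab by (intro support_fun_le body) (auto simp: inner_commute less_imp_le)
    moreover have "x \<bullet> (- a) \<le> support_fun Q (- a)" using x by blast
    ultimately show False using ab(1) by (simp add: inner_commute)
  qed
qed

lemma convex_body_eqI:
  assumes Q: "Q \<in> convex_bodies_o" and Q': "Q' \<in> convex_bodies_o"
    and eq: "\<And>u. norm u = 1 \<Longrightarrow> support_fun Q u = support_fun Q' u"
  shows "Q = Q'"
proof -
  note h = positive_sublinear_support_fun[OF Q] and h' = positive_sublinear_support_fun[OF Q']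
  have "support_fun Q u = support_fun Q' u" for u
  proof (cases "u = 0")
    case False
    then have "support_fun Q (u /\<^sub>R norm u) = support_fun Q' (u /\<^sub>R norm u)" by (intro eq) simp
    then show ?thesis
      using False positive_sublinearD(2)[OF h, of "norm u" "u /\<^sub>R norm u"]
        positive_sublinearD(2)[OF h', of "norm u" "u /\<^sub>R norm u"] by simp
  qed (simp add: positive_sublinear_zero[OF h] positive_sublinear_zero[OF h'])
  then show ?thesis
    using convex_body_eq_support_halfspaces[OF Q] convex_body_eq_support_halfspaces[OF Q'] by simp
qed

text \<open>The point of the body needed to recover \<open>h v\<close> comes from separating \<open>v / s\<close> (for \<open>s < h v\<close>)
  from the unit sublevel set of \<open>h\<close>, which plays the role of the polar body.\<close>
lemma positive_sublinear_is_support_fun: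
  fixes h :: "'a::euclidean_space \<Rightarrow> real"
  assumes h: "positive_sublinear h"
  obtains Q where "Q \<in> convex_bodies_o" "support_fun Q = h"
proof -
  obtain e R where eR: "0 < e" "0 < R" "\<And>u. e * norm u \<le> h u" "\<And>u. h u \<le> R * norm u"
    using positive_sublinear_bounds[OF h] by metis
  define Q where "Q = {x. \<forall>u. x \<bullet> u \<le> h u}"
  have Q_eq: "Q = (\<Inter>u. {x. u \<bullet> x \<le> h u})" by (auto simp: Q_def inner_commute)
  have cl: "closed Q" unfolding Q_eq by (intro closed_INT ballI closed_halfspace_le)
  have conv: "convex Q" unfolding Q_eq by (intro convex_INT ballI convex_halfspace_le)
  have bdd: "bounded Q"
  proof (rule boundedI)
    fix x assume "x \<in> Q"
    then have "x \<bullet> x \<le> h x" by (simp add: Q_def)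
    also have "\<dots> \<le> R * norm x" by (rule eR)
    finally have "norm x * norm x \<le> R * norm x" by (simp add: power2_norm_eq_inner[symmetric] power2_eq_square)
    then show "norm x \<le> R" using eR(2) by (cases "x = 0") auto
  qed
  have "ball 0 e \<subseteq> Q"
  proof
    fix x :: 'a assume x: "x \<in> ball 0 e"
    have "x \<bullet> u \<le> h u" for u
    proof -
      have "x \<bullet> u \<le> norm x * norm u" by (rule norm_cauchy_schwarz)
      also have "\<dots> \<le> e * norm u" using x by (intro mult_right_mono) auto
      also have "\<dots> \<le> h u" by (rule eR)
      finally show ?thesis .
    qed
    then show "x \<in> Q" by (simp add: Q_def)
  qed
  then have int: "0 \<in> interior Q" using eR(1) by (meson centre_in_ball interior_maximal open_ball subsetD)
  have Qb: "Q \<in> convex_bodies_o" using cl conv bdd int by (simp add: convex_bodies_o_def compact_eq_bounded_closed)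
  have "support_fun Q v = h v" for v
  proof (cases "v = 0")
    case True
    then show ?thesis using positive_sublinear_zero[OF h] positive_sublinear_zero[OF positive_sublinear_support_fun[OF Qb]] by simp
  next
    case False
    have "support_fun Q v \<le> h v" using convex_bodies_oD[OF Qb] by (intro support_fun_le) (auto simp: Q_def)
    moreover have "h v \<le> support_fun Q v"
    proof (rule dense_le_bounded[OF positive_sublinearD(3)[OF h False]])
      fix s assume s: "0 < s" "s < h v"
      define P where "P = {y. h y \<le> 1}"
      have "closed P" unfolding P_def
        by (intro closed_Collect_le positive_sublinear_continuous[OF h] continuous_intros)
      moreover have "convex P"
      proof (rule convexI)
        fix x y t t' assume "x \<in> P" "y \<in> P" "0 \<le> t" "0 \<le> t'" "t + t' = (1::real)"
        then have "t * h x + t' * h y \<le> t * 1 + t' * 1" by (intro add_mono mult_left_mono) (auto simp: P_def)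
        then show "t *\<^sub>R x + t' *\<^sub>R y \<in> P"
          using positive_sublinearD(1)[OF h, of "t *\<^sub>R x" "t' *\<^sub>R y"] positive_sublinearD(2)[OF h] \<open>0 \<le> t\<close> \<open>0 \<le> t'\<close> \<open>t + t' = 1\<close>
          by (simp add: P_def)
      qed
      moreover have "(1 / s) *\<^sub>R v \<notin> P" using s positive_sublinearD(2)[OF h, of "1 / s" v] by (simp add: P_def)
      ultimately obtain a b where ab: "a \<bullet> ((1 / s) *\<^sub>R v) < b" "\<forall>y\<in>P. a \<bullet> y > b"
        using separating_hyperplane_closed_point by blast
      have "0 \<in> P" by (simp add: P_def positive_sublinear_zero[OF h])
      then have b: "b < 0" using ab(2) by force
      \<comment> \<open>Since \<open>0 \<in> P\<close>, the number \<open>b\<close> is negative and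
        dividing by it reverses the separation: \<open>x\<close> pairs to less than 1 with all of
        \<open>P\<close>, which by homogeneity puts it into \<open>Q\<close>, and to at least
        \<open>s\<close> with \<open>v\<close>.\<close>
      define x where "x = (1 / b) *\<^sub>R a"
      have "x \<bullet> u \<le> h u" for u
      proof (cases "u = 0")
        case False
        have hu: "0 < h u" by (rule positive_sublinearD(3)[OF h False])
        then have "(1 / h u) *\<^sub>R u \<in> P" using positive_sublinearD(2)[OF h, of "1 / h u" u] by (simp add: P_def)
        then have "a \<bullet> ((1 / h u) *\<^sub>R u) > b" using ab(2) by blast
        then have "a \<bullet> u > b * h u" using hu by (simp add: field_simps)
        then show ?thesis using b by (simp add: x_def field_simps)
      qed (simp add: positive_sublinear_zero[OF h])
      then have "x \<in> Q" by (simp add: Q_def)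
      then have "x \<bullet> v \<le> support_fun Q v" by (rule inner_le_support_fun[OF bdd])
      moreover have "a \<bullet> v < b * s" using ab(1) s by (simp add: field_simps)
      then have "s \<le> x \<bullet> v" using b by (simp add: x_def field_simps)
      ultimately show "s \<le> support_fun Q v" by linarith
    qed
    ultimately show ?thesis by linarith
  qed
  then show ?thesis using that Qb by blast
qed

lemma radial_fun_polar_body:
  assumes Q: "Q \<in> convex_bodies_o" and u: "u \<noteq> 0"
  shows "radial_fun (polar_body Q) u = 1 / support_fun Q u"
proof -
  note body = convex_bodies_oD[OF Q]
  have pos: "0 < support_fun Q u" by (rule positive_sublinearD(3)[OF positive_sublinear_support_fun[OF Q] u])
  have "r *\<^sub>R u \<in> polar_body Q \<longleftrightarrow> r * support_fun Q u \<le> 1" if "0 \<le> r" for r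
  proof
    assume r: "r *\<^sub>R u \<in> polar_body Q"
    show "r * support_fun Q u \<le> 1"
    proof (cases "r = 0")
      case False
      then have "support_fun Q u \<le> 1 / r"
        using r that by (intro support_fun_le body) (auto simp: polar_body_def inner_commute field_simps)
      then show ?thesis using that False by (simp add: field_simps)
    qed simp
  next
    assume r: "r * support_fun Q u \<le> 1"
    have "r * (y \<bullet> u) \<le> r * support_fun Q u" if "y \<in> Q" for y
      using that \<open>0 \<le> r\<close> by (intro mult_left_mono inner_le_support_fun body)
    then show "r *\<^sub>R u \<in> polar_body Q" using r by (fastforce simp: polar_body_def inner_commute)
  qed
  then have "{r. 0 \<le> r \<and> r *\<^sub>R u \<in> polar_body Q} = {0..1 / support_fun Q u}"
    using pos by (auto simp: field_simps)
  then show ?thesis using pos by (simp add: radial_fun_def)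
qed

lemma radial_fun_cball: "norm u = 1 \<Longrightarrow> radial_fun (cball 0 1) u = 1"
proof -
  assume "norm u = 1"
  then have "{r. 0 \<le> r \<and> r *\<^sub>R u \<in> cball 0 1} = {0..1}" by auto
  then show ?thesis by (simp add: radial_fun_def)
qed

section \<open>Dual volumes as functions of the support function\<close>

lemma integrable_continuous_on_sphere:
  fixes f :: "'a::euclidean_space \<Rightarrow> real"
  assumes "finite_measure M" and M: "sets M = sets (restrict_space borel (sphere 0 1))"
    and f: "continuous_on (sphere 0 1) f"
  shows "integrable M f"
proof -
  interpret finite_measure M by fact
  have sp: "space M = sphere 0 1" using sets_eq_imp_space_eq[OF M] by (simp add: space_restrict_space)
  have "bounded (f ` sphere 0 1)" by (intro compact_imp_bounded compact_continuous_image f compact_sphere)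
  then obtain B where "\<And>u. u \<in> sphere 0 1 \<Longrightarrow> norm (f u) \<le> B" unfolding bounded_iff by blast
  then show ?thesis
    by (intro integrable_const_bound[where B = B] borel_measurable_on_sphere[OF M f]) (auto simp: sp)
qed

text \<open>By continuity the strict inequality at \<open>v\<close> spreads to a relatively open
  subset of the sphere, which has positive measure; an integral of \<open>g - f\<close> equal to 0
  would make that set a null set.\<close>

lemma integral_spherical_strict_mono:
  fixes f g :: "'a::euclidean_space \<Rightarrow> real"
  assumes f: "continuous_on (sphere 0 1) f" and g: "continuous_on (sphere 0 1) g"
    and le: "\<And>u. norm u = 1 \<Longrightarrow> f u \<le> g u" and less: "norm v = 1" "f v < g v"
  shows "(\<integral>u. f u \<partial>spherical_measure) < (\<integral>u. g u \<partial>spherical_measure)"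
proof -
  let ?S = "spherical_measure :: 'a measure"
  have int: "integrable ?S f" "integrable ?S g"
    by (intro integrable_continuous_on_sphere finite_measure_spherical_measure sets_spherical_measure f g)+
  have int': "integrable ?S (\<lambda>u. g u - f u)" using int by (rule Bochner_Integration.integrable_diff[rotated])
  have nonneg: "AE u in ?S. 0 \<le> g u - f u" using le by (intro AE_I2) auto
  have "(\<integral>u. g u - f u \<partial>?S) \<noteq> 0"
  proof
    assume "(\<integral>u. g u - f u \<partial>?S) = 0"
    then have ae: "AE u in ?S. g u - f u = 0" using integral_nonneg_eq_0_iff_AE[OF int' nonneg] by simp
    have "continuous_on (sphere 0 1) (\<lambda>u. g u - f u)" by (intro continuous_intros f g)
    then obtain U where U: "open U" "U \<inter> sphere 0 1 = (\<lambda>u. g u - f u) -` {0<..} \<inter> sphere 0 1"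
      unfolding continuous_on_open_invariant using open_greaterThan by metis
    have key: "u \<in> U \<longleftrightarrow> 0 < g u - f u" if "norm u = 1" for u
      using U(2) that by (auto simp: set_eq_iff)
    have "AE u in ?S. u \<notin> sphere 0 1 \<inter> U"
      using ae by (rule eventually_mono) (auto simp: key)
    then have "emeasure ?S (sphere 0 1 \<inter> U) = 0"
      using AE_iff_null_sets[OF sets_sphere_Int[OF sets_spherical_measure borel_open[OF U(1)]]] by blast
    moreover have "v \<in> U" using less by (simp add: key)
    ultimately show False using emeasure_spherical_open_pos[OF U(1) _ less(1)] by simp
  qed
  moreover have "0 \<le> (\<integral>u. g u - f u \<partial>?S)" by (rule integral_nonneg_AE[OF nonneg])
  ultimately show ?thesis using int by (simp add: Bochner_Integration.integral_diff)
qed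

lemma continuous_on_compose_pair:
  assumes H: "continuous_on ({0<..} \<times> S) (\<lambda>(t::real, u). H t u)"
    and h: "continuous_on S h" "\<And>u. u \<in> S \<Longrightarrow> 0 < h u"
  shows "continuous_on S (\<lambda>u. H (h u) u)"
proof -
  have "continuous_on S (\<lambda>u. (\<lambda>(t, u). H t u) (h u, u))"
    by (rule continuous_on_compose2[OF H]) (auto intro!: continuous_intros h)
  then show ?thesis by simp
qed

text \<open>The values of \<open>hn\<close> stay in the compact interval from \<open>e\<close> to
  \<open>R\<close>, away from the boundary of the domain of \<open>H\<close>, so a constant
  dominates. Measure and integrand are kept general to serve both the volume and the Orlicz
  integral.\<close>

lemma integral_sphere_bounded_convergence:
  fixes H :: "real \<Rightarrow> 'a::euclidean_space \<Rightarrow> real"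
  assumes fin: "finite_measure M" and M: "sets M = sets (restrict_space borel (sphere 0 1))"
    and H: "continuous_on ({0<..} \<times> sphere 0 1) (\<lambda>(t, u). H t u)"
    and hn: "\<And>n. continuous_on (sphere 0 1) (hn n)" and h: "continuous_on (sphere 0 1) h"
    and e: "0 < e" and bounds: "\<And>n u. norm u = 1 \<Longrightarrow> e \<le> hn n u \<and> hn n u \<le> R"
    and lim: "\<And>u. norm u = 1 \<Longrightarrow> (\<lambda>n. hn n u) \<longlonglongrightarrow> h u"
  shows "(\<lambda>n. \<integral>u. H (hn n u) u \<partial>M) \<longlonglongrightarrow> (\<integral>u. H (h u) u \<partial>M)"
proof -
  interpret finite_measure M by fact
  have sp: "space M = sphere 0 1" using sets_eq_imp_space_eq[OF M] by (simp add: space_restrict_space)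
  have h_ge: "e \<le> h u" if "norm u = 1" for u
    using lim[OF that] bounds[OF that] by (intro LIMSEQ_le_const) auto
  have "compact ({e..R} \<times> sphere (0::'a) 1)" by (intro compact_Times) auto
  moreover have "continuous_on ({e..R} \<times> sphere 0 1) (\<lambda>(t, u). H t u)"
    by (rule continuous_on_subset[OF H]) (use e in auto)
  ultimately have "bounded ((\<lambda>(t, u). H t u) ` ({e..R} \<times> sphere 0 1))"
    by (intro compact_imp_bounded compact_continuous_image)
  then obtain B where B: "\<And>t u. t \<in> {e..R} \<Longrightarrow> u \<in> sphere 0 1 \<Longrightarrow> norm (H t u) \<le> B"
    unfolding bounded_iff by fastforce
  have pos: "0 < hn n u" "0 < h u" if "u \<in> sphere 0 1" for n u
    using e bounds[of u n] h_ge[of u] that by auto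
  show ?thesis
  proof (rule integral_dominated_convergence[where w = "\<lambda>_. B"])
    show "(\<lambda>u. H (h u) u) \<in> borel_measurable M"
      by (intro borel_measurable_on_sphere[OF M] continuous_on_compose_pair[OF H h] pos)
    show "(\<lambda>u. H (hn n u) u) \<in> borel_measurable M" for n
      by (intro borel_measurable_on_sphere[OF M] continuous_on_compose_pair[OF H hn] pos)
    show "AE u in M. (\<lambda>n. H (hn n u) u) \<longlonglongrightarrow> H (h u) u"
    proof (rule AE_I2)
      fix u assume "u \<in> space M"
      then have u: "u \<in> sphere 0 1" by (simp add: sp)
      then have "(\<lambda>n. (hn n u, u)) \<longlonglongrightarrow> (h u, u)" using lim by (intro tendsto_intros) auto
      then have "(\<lambda>n. (\<lambda>(t, u). H t u) (hn n u, u)) \<longlonglongrightarrow> (\<lambda>(t, u). H t u) (h u, u)"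
        by (rule continuous_on_tendsto_compose[OF H]) (use u pos in auto)
      then show "(\<lambda>n. H (hn n u) u) \<longlonglongrightarrow> H (h u) u" by simp
    qed
    show "AE u in M. norm (H (hn n u) u) \<le> B" for n
      using bounds by (intro AE_I2 B) (auto simp: sp)
  qed simp
qed

text \<open>The dual volume of the polar of the body with support function \<open>h\<close>. As a
  functional of functions it can be applied to multiples and averages before any body is constructed
  for them.\<close>

definition sphere_vol :: "(real \<Rightarrow> 'a::euclidean_space \<Rightarrow> real) \<Rightarrow> ('a \<Rightarrow> real) \<Rightarrow> real" where
  "sphere_vol G h = (\<integral>u. G (1 / h u) u \<partial>spherical_measure)"

lemma class_G_I_dest:
  assumes "G \<in> class_G_I"
  shows "continuous_on ({0<..} \<times> sphere 0 1) (\<lambda>(t, u). G t u)"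
    and "0 < t \<Longrightarrow> norm u = 1 \<Longrightarrow> 0 < G t u"
    and "0 < s \<Longrightarrow> s < t \<Longrightarrow> norm u = 1 \<Longrightarrow> G s u < G t u"
    and "0 < s \<Longrightarrow> s \<le> t \<Longrightarrow> norm u = 1 \<Longrightarrow> G s u \<le> G t u"
    and "norm u = 1 \<Longrightarrow> ((\<lambda>t. G t u) \<longlongrightarrow> 0) (at_right 0)"
  using assms unfolding class_G_I_def strict_mono_on_def
  by (auto simp: order_le_less)

lemma class_G_I_continuous:
  assumes G: "G \<in> class_G_I" and h: "continuous_on (sphere 0 1) h" "\<And>u. norm u = 1 \<Longrightarrow> 0 < h u"
  shows "continuous_on (sphere 0 1) (\<lambda>u. G (1 / h u) u)"
  using h by (intro continuous_on_compose_pair[OF class_G_I_dest(1)[OF G]] continuous_intros) (auto simp: less_imp_neq[symmetric])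

lemma sphere_vol_strict_antimono:
  assumes G: "G \<in> class_G_I"
    and h: "continuous_on (sphere 0 1) h" "\<And>u. norm u = 1 \<Longrightarrow> 0 < h u"
    and h': "continuous_on (sphere 0 1) h'" "\<And>u. norm u = 1 \<Longrightarrow> h u < h' u"
  shows "sphere_vol G h' < sphere_vol G h"
proof -
  obtain v :: 'a where v: "norm v = 1" using vector_choose_size[of 1] by auto
  have pos: "0 < h' u" if "norm u = 1" for u using h(2) h'(2) that by (meson order.strict_trans)
  have *: "G (1 / h' u) u < G (1 / h u) u" if u: "norm u = 1" for u
    using h(2)[OF u] h'(2)[OF u] pos[OF u] by (intro class_G_I_dest(3)[OF G _ _ u]) (auto simp: frac_less2)
  show ?thesis
    unfolding sphere_vol_def
    by (rule integral_spherical_strict_mono[OF class_G_I_continuous[OF G h'(1) pos] class_G_I_continuous[OF G h] _ v])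
      (use * v in \<open>auto intro: less_imp_le\<close>)
qed

lemma sphere_vol_convergence:
  fixes h :: "'a::euclidean_space \<Rightarrow> real"
  assumes G: "G \<in> class_G_I"
    and hn: "\<And>n. continuous_on (sphere 0 1) (hn n)" and h: "continuous_on (sphere 0 1) h"
    and e: "0 < e" and bounds: "\<And>n u. norm u = 1 \<Longrightarrow> e \<le> hn n u \<and> hn n u \<le> R"
    and lim: "\<And>u. norm u = 1 \<Longrightarrow> (\<lambda>n. hn n u) \<longlonglongrightarrow> h u"
  shows "(\<lambda>n. sphere_vol G (hn n)) \<longlonglongrightarrow> sphere_vol G h"
  unfolding sphere_vol_def
proof (rule integral_sphere_bounded_convergence[where H = "\<lambda>t u. G (1 / t) u", OF finite_measure_spherical_measure sets_spherical_measure _ hn h e bounds lim])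
  have "continuous_on ({0<..} \<times> sphere 0 1) (\<lambda>x::real \<times> 'a. (\<lambda>(t, u). G t u) (1 / fst x, snd x))"
    by (rule continuous_on_compose2[OF class_G_I_dest(1)[OF G]]) (auto intro!: continuous_intros)
  then show "continuous_on ({0<..} \<times> sphere 0 1) (\<lambda>(t, u). G (1 / t) u)"
    by (simp add: split_beta)
qed

section \<open>Scaling and the homogeneous dual volume\<close>

text \<open>The threshold \<open>T\<close> is left free, not fixed at 1, because replacing
  \<open>t\<close> by \<open>t / r\<close> moves it.\<close>

definition sphere_growth :: "(real \<Rightarrow> 'a::euclidean_space \<Rightarrow> real) \<Rightarrow> bool" where
  "sphere_growth G \<longleftrightarrow> (\<exists>c>0. \<exists>T>0. \<forall>t\<ge>T. \<forall>u. norm u = 1 \<longrightarrow> c * t ^ (DIM('a) - 1) \<le> G t u)"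

lemma measure_sphere_pos: "0 < measure (spherical_measure :: 'a::euclidean_space measure) (sphere 0 1)"
proof -
  interpret finite_measure "spherical_measure :: 'a measure" by (rule finite_measure_spherical_measure)
  obtain v :: 'a where v: "norm v = 1" using vector_choose_size[of 1] by auto
  have "0 < emeasure (spherical_measure :: 'a measure) (sphere 0 1)"
    using emeasure_spherical_open_pos[OF open_UNIV _ v] by simp
  then show ?thesis by (simp add: emeasure_eq_measure)
qed

text \<open>Intermediate value theorem in the scale: a small scale pushes the volume above
  \<open>a\<close> by the growth of \<open>G\<close>, a large one below \<open>a\<close> because
  \<open>G\<close> vanishes at 0.\<close>

lemma sphere_vol_scale_exists:
  fixes h :: "'a::euclidean_space \<Rightarrow> real"
  assumes dim: "2 \<le> DIM('a)" and G: "G \<in> class_G_I" and gr: "sphere_growth G"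
    and h: "continuous_on (sphere 0 1) h" "\<And>u. norm u = 1 \<Longrightarrow> 0 < h u" and a: "0 < a"
  obtains r where "0 < r" "sphere_vol G (\<lambda>u. r * h u) = a"
proof -
  let ?S = "spherical_measure :: 'a measure" and ?V = "\<lambda>r. sphere_vol G (\<lambda>u. r * h u)"
  interpret finite_measure ?S by (rule finite_measure_spherical_measure)
  have ne: "sphere (0::'a) 1 \<noteq> {}" by simp
  obtain x where x: "x \<in> sphere 0 1" "\<And>u. u \<in> sphere 0 1 \<Longrightarrow> h x \<le> h u"
    using continuous_attains_inf[OF compact_sphere ne h(1)] by blast
  obtain y where y: "y \<in> sphere 0 1" "\<And>u. u \<in> sphere 0 1 \<Longrightarrow> h u \<le> h y"
    using continuous_attains_sup[OF compact_sphere ne h(1)] by blast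
  have hx: "0 < h x" using x h(2) by simp
  have hy: "0 < h y" using y h(2) by simp
  have cont_scale: "continuous_on (sphere 0 1) (\<lambda>u. r * h u)" for r by (intro continuous_intros h)
  have int: "integrable ?S (\<lambda>u. G (1 / (r * h u)) u)" if "0 < r" for r
    using that h(2) by (intro integrable_continuous_on_sphere finite_measure_spherical_measure
        sets_spherical_measure class_G_I_continuous[OF G cont_scale]) auto
  have cont: "continuous_on {p..q} ?V" if "0 < p" for p q
  proof (unfold continuous_on_sequentially, intro allI ballI impI)
    fix X z assume z: "z \<in> {p..q}" and X: "(\<forall>n. X n \<in> {p..q}) \<and> X \<longlonglongrightarrow> z"
    show "(?V \<circ> X) \<longlonglongrightarrow> ?V z"
      unfolding comp_def
    proof (rule sphere_vol_convergence[OF G cont_scale cont_scale])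
      show "0 < p * h x" using that hx by simp
      show "p * h x \<le> X n * h u \<and> X n * h u \<le> q * h y" if "norm u = 1" for n u
      proof -
        have "p \<le> X n" "X n \<le> q" using X by auto
        moreover from this \<open>0 < p\<close> have "0 \<le> X n" by linarith
        ultimately show ?thesis using x(2)[of u] y(2)[of u] hx that \<open>0 < p\<close> by (intro conjI mult_mono) auto
      qed
      show "(\<lambda>n. X n * h u) \<longlonglongrightarrow> z * h u" for u
        using X by (intro tendsto_intros) auto
    qed
  qed
  obtain p where p: "0 < p" "a \<le> ?V p"
  proof -
    obtain c T where c: "0 < c" "0 < T" "\<And>t u. T \<le> t \<Longrightarrow> norm u = 1 \<Longrightarrow> c * t ^ (DIM('a) - 1) \<le> G t u"
      using gr unfolding sphere_growth_def by blast
    define m where "m = measure ?S (sphere 0 1)"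
    have m: "0 < m" unfolding m_def by (rule measure_sphere_pos)
    \<comment> \<open>Chosen so that the constant \<open>c * t\<close> integrates to at least
      \<open>a\<close>; the scale \<open>p\<close> below is so small that
      \<open>1 / (p * h u)\<close> is at least \<open>t\<close> at every point.\<close>
    define t where "t = max (max 1 T) (a / (m * c))"
    have t: "1 \<le> t" "T \<le> t" "a / (m * c) \<le> t" by (auto simp: t_def)
    define p where "p = 1 / (t * h y)"
    have p: "0 < p" unfolding p_def using t hy by simp
    have ge: "c * t \<le> G (1 / (p * h u)) u" if u: "norm u = 1" for u
    proof -
      have "t * h u \<le> t * h y" using y(2)[of u] u t by (intro mult_left_mono) auto
      then have "t \<le> 1 / (p * h u)" using h(2)[OF u] hy t by (simp add: p_def field_simps)
      \<comment> \<open>The dimension hypothesis makes the exponent at least 1.\<close>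
      have "t ^ 1 \<le> t ^ (DIM('a) - 1)" using dim t by (intro power_increasing) auto
      then have "c * t \<le> c * t ^ (DIM('a) - 1)" using c by simp
      also have "\<dots> \<le> G t u" using t u by (intro c)
      also have "\<dots> \<le> G (1 / (p * h u)) u" using t u \<open>t \<le> 1 / (p * h u)\<close> by (intro class_G_I_dest(4)[OF G]) auto
      finally show ?thesis .
    qed
    have "a \<le> m * (c * t)" using t(3) m c by (simp add: field_simps)
    also have "\<dots> = (\<integral>u. c * t \<partial>?S)" by (simp add: m_def)
    also have "\<dots> \<le> ?V p"
      unfolding sphere_vol_def using ge p by (intro integral_mono int) auto
    finally show ?thesis by (rule that[OF p])
  qed
  obtain q where q: "p \<le> q" "?V q \<le> a"
  proof -
    \<comment> \<open>By monotonicity of \<open>G\<close> the integrand at scale \<open>p\<close>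
      dominates those at all larger scales, so its pointwise decay carries over to the
      integrals.\<close>
    have "(\<lambda>n. ?V (p * real (Suc n))) \<longlonglongrightarrow> (\<integral>u. 0 \<partial>?S)"
      unfolding sphere_vol_def
    proof (rule integral_dominated_convergence[where w = "\<lambda>u. G (1 / (p * h u)) u"])
      show "integrable ?S (\<lambda>u. G (1 / (p * h u)) u)" by (rule int[OF p(1)])
      show "(\<lambda>u. G (1 / (p * real (Suc n) * h u)) u) \<in> borel_measurable ?S" for n
        using int[of "p * real (Suc n)"] p by auto
      show "AE u in ?S. (\<lambda>n. G (1 / (p * real (Suc n) * h u)) u) \<longlonglongrightarrow> 0"
      proof (rule AE_I2)
        fix u assume "u \<in> space ?S"
        then have u: "norm u = 1" by simp
        have "(\<lambda>n. (1 / (p * h u)) * inverse (real (Suc n))) \<longlonglongrightarrow> (1 / (p * h u)) * 0"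
          by (rule tendsto_mult[OF tendsto_const LIMSEQ_inverse_real_of_nat])
        then have "(\<lambda>n. 1 / (p * real (Suc n) * h u)) \<longlonglongrightarrow> 0"
          by (simp add: divide_inverse mult_ac del: of_nat_Suc)
        then have "filterlim (\<lambda>n. 1 / (p * real (Suc n) * h u)) (at_right 0) sequentially"
          unfolding filterlim_at using p h(2)[OF u] by auto
        then show "(\<lambda>n. G (1 / (p * real (Suc n) * h u)) u) \<longlonglongrightarrow> 0"
          by (rule filterlim_compose[OF class_G_I_dest(5)[OF G u]])
      qed
      show "AE u in ?S. norm (G (1 / (p * real (Suc n) * h u)) u) \<le> G (1 / (p * h u)) u" for n
      proof (rule AE_I2)
        fix u assume "u \<in> space ?S"
        then have u: "norm u = 1" by simp
        have hu: "0 < h u" by (rule h(2)[OF u])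
        have "p * h u * 1 \<le> p * h u * real (Suc n)" using p hu by (intro mult_left_mono) auto
        then have "1 / (p * real (Suc n) * h u) \<le> 1 / (p * h u)" using p hu
          by (intro divide_left_mono) (auto simp: mult_ac)
        then have "G (1 / (p * real (Suc n) * h u)) u \<le> G (1 / (p * h u)) u"
          using p hu by (intro class_G_I_dest(4)[OF G _ _ u]) auto
        moreover have "0 < G (1 / (p * real (Suc n) * h u)) u"
          using p hu by (intro class_G_I_dest(2)[OF G _ u]) auto
        ultimately show "norm (G (1 / (p * real (Suc n) * h u)) u) \<le> G (1 / (p * h u)) u" by simp
      qed
    qed simp
    then have "(\<lambda>n. ?V (p * real (Suc n))) \<longlonglongrightarrow> 0" by simp
    then have "\<forall>\<^sub>F n in sequentially. ?V (p * real (Suc n)) < a" using a by (rule order_tendstoD)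
    then obtain n where "?V (p * real (Suc n)) < a" using eventually_happens'[OF sequentially_bot] by blast
    moreover have "p \<le> p * real (Suc n)" using p by simp
    ultimately show ?thesis using that[of "p * real (Suc n)"] by (simp del: of_nat_Suc)
  qed
  obtain r where "p \<le> r" "r \<le> q" "?V r = a"
    using IVT2'[OF q(2) p(2) q(1) cont[OF p(1)]] by blast
  then show ?thesis using that[of r] p by simp
qed

lemma dual_vol_polar_body:
  assumes Q: "Q \<in> convex_bodies_o"
  shows "dual_vol G (polar_body Q) = sphere_vol G (support_fun Q)"
  unfolding dual_vol_def sphere_vol_def
proof (rule Bochner_Integration.integral_cong[OF refl])
  fix u :: 'a assume "u \<in> space spherical_measure"
  then have "u \<noteq> 0" by auto
  then show "G (radial_fun (polar_body Q) u) u = G (1 / support_fun Q u) u"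
    by (simp add: radial_fun_polar_body[OF Q])
qed

lemma dual_vol_cball: "dual_vol G (cball 0 1) = sphere_vol G norm"
  unfolding dual_vol_def sphere_vol_def
  by (rule Bochner_Integration.integral_cong[OF refl]) (simp add: radial_fun_cball)

lemma hom_dual_vol_polar_body:
  assumes Q: "Q \<in> convex_bodies_o"
  shows "hom_dual_vol G (polar_body Q) = Inf {r. r > 0 \<and> sphere_vol G (\<lambda>u. r * support_fun Q u) \<le> 1}"
proof -
  have "(\<integral>u. G (radial_fun (polar_body Q) u / r) u \<partial>spherical_measure) = sphere_vol G (\<lambda>u. r * support_fun Q u)" for r
    unfolding sphere_vol_def
  proof (rule Bochner_Integration.integral_cong[OF refl])
    fix u :: 'a assume "u \<in> space spherical_measure"
    then have "u \<noteq> 0" by auto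
    then show "G (radial_fun (polar_body Q) u / r) u = G (1 / (r * support_fun Q u)) u"
      by (simp add: radial_fun_polar_body[OF Q] mult.commute)
  qed
  then show ?thesis by (simp add: hom_dual_vol_def)
qed

lemma hom_dual_vol_cball:
  "hom_dual_vol G (cball 0 1) = Inf {r. r > 0 \<and> sphere_vol G (\<lambda>u. r * norm u) \<le> 1}"
proof -
  have "(\<integral>u. G (radial_fun (cball 0 1) u / r) u \<partial>spherical_measure) = sphere_vol G (\<lambda>u. r * norm u)" for r
    unfolding sphere_vol_def
    by (rule Bochner_Integration.integral_cong[OF refl]) (simp add: radial_fun_cball)
  then show ?thesis by (simp add: hom_dual_vol_def)
qed

text \<open>The volume is strictly decreasing in the scale, so every scale below \<open>r\<close>
  has volume above 1 and the infimum is attained at \<open>r\<close>.\<close>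

lemma Inf_sphere_vol_scale:
  fixes h :: "'a::euclidean_space \<Rightarrow> real"
  assumes G: "G \<in> class_G_I" and h: "positive_sublinear h" and r: "0 < r" "sphere_vol G (\<lambda>u. r * h u) = 1"
  shows "Inf {s. s > 0 \<and> sphere_vol G (\<lambda>u. s * h u) \<le> 1} = r"
proof (rule cInf_eq_minimum)
  show "r \<in> {s. s > 0 \<and> sphere_vol G (\<lambda>u. s * h u) \<le> 1}" using r by simp
  fix s assume s: "s \<in> {s. s > 0 \<and> sphere_vol G (\<lambda>u. s * h u) \<le> 1}"
  have pos: "0 < h u" if "norm u = 1" for u
    using that by (intro positive_sublinearD(3)[OF h]) auto
  show "r \<le> s"
  proof (rule ccontr)
    assume "\<not> r \<le> s"
    then have "sphere_vol G (\<lambda>u. r * h u) < sphere_vol G (\<lambda>u. s * h u)"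
      using s pos by (intro sphere_vol_strict_antimono[OF G] continuous_intros positive_sublinear_continuous[OF h]) auto
    then show False using s r by simp
  qed
qed

lemma B_tilde_iff:
  "Q \<in> B_tilde G \<longleftrightarrow> Q \<in> convex_bodies_o \<and> sphere_vol G (support_fun Q) = sphere_vol G norm"
  by (auto simp: B_tilde_def dual_vol_polar_body dual_vol_cball)

text \<open>The scale \<open>r\<close> is the homogeneous volume of the ball. A body has the same
  homogeneous volume exactly when its support function has volume 1 at this scale, and 1 is also the
  volume of the ball for the rescaled integrand.\<close>

lemma B_hat_eq_B_tilde:
  fixes G :: "real \<Rightarrow> 'a::euclidean_space \<Rightarrow> real"
  assumes dim: "2 \<le> DIM('a)" and G: "G \<in> class_G_I" and gr: "sphere_growth G"
  obtains r where "0 < r" "B_hat G = B_tilde (\<lambda>t. G (t / r))"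
proof -
  have pos: "0 < h u" if "norm u = 1" "positive_sublinear h" for u and h :: "'a \<Rightarrow> real"
    using that by (intro positive_sublinearD(3)) auto
  have ex: "\<exists>r>0. sphere_vol G (\<lambda>u. r * h u) = 1" if "positive_sublinear h" for h :: "'a \<Rightarrow> real"
    using sphere_vol_scale_exists[OF dim G gr positive_sublinear_continuous[OF that] pos[OF _ that], of 1] by auto
  obtain r where r: "0 < r" "sphere_vol G (\<lambda>u::'a. r * norm u) = 1"
    using ex[OF positive_sublinear_norm] by blast
  have vol: "sphere_vol (\<lambda>t. G (t / r)) h = sphere_vol G (\<lambda>u. r * h u)" for h
    by (simp add: sphere_vol_def mult.commute)
  have ball: "hom_dual_vol G (cball 0 1) = r"
    unfolding hom_dual_vol_cball by (rule Inf_sphere_vol_scale[OF G positive_sublinear_norm r])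
  have iff: "hom_dual_vol G (polar_body Q) = r \<longleftrightarrow> sphere_vol G (\<lambda>u. r * support_fun Q u) = 1"
    if Q: "Q \<in> convex_bodies_o" for Q
  proof -
    note h = positive_sublinear_support_fun[OF Q]
    obtain s where s: "0 < s" "sphere_vol G (\<lambda>u. s * support_fun Q u) = 1" using ex[OF h] by blast
    have "hom_dual_vol G (polar_body Q) = s"
      unfolding hom_dual_vol_polar_body[OF Q] by (rule Inf_sphere_vol_scale[OF G h s])
    moreover have "r = s" if "sphere_vol G (\<lambda>u. r * support_fun Q u) = 1"
      using Inf_sphere_vol_scale[OF G h s] Inf_sphere_vol_scale[OF G h r(1) that] by simp
    ultimately show ?thesis using s by blast
  qed
  have "Q \<in> B_hat G \<longleftrightarrow> Q \<in> B_tilde (\<lambda>t. G (t / r))" for Q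
    unfolding B_tilde_iff vol r(2) B_hat_def mem_Collect_eq ball using iff by blast
  then have "B_hat G = B_tilde (\<lambda>t. G (t / r))" by blast
  then show ?thesis using that r by blast
qed

lemma class_G_I_rescale:
  assumes G: "G \<in> class_G_I" and r: "0 < r"
  shows "(\<lambda>t. G (t / r)) \<in> class_G_I"
proof -
  have "continuous_on ({0<..} \<times> sphere 0 1) (\<lambda>x::real \<times> 'a. (\<lambda>(t, u). G t u) (fst x / r, snd x))"
    using r by (intro continuous_on_compose2[OF class_G_I_dest(1)[OF G]]) (auto intro!: continuous_intros)
  then have c: "continuous_on ({0<..} \<times> sphere 0 1) (\<lambda>(t, u). G (t / r) u)" by (simp add: split_beta)
  have l0: "filterlim (\<lambda>t. t / r) (at_right 0) (at_right 0)"
  proof -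
    have "((\<lambda>t. t / r) \<longlongrightarrow> 0 / r) (at_right 0)" by (intro tendsto_intros) (use r in auto)
    moreover have "\<forall>\<^sub>F t in at_right 0. t / r \<in> {0<..} \<and> t / r \<noteq> 0"
      using eventually_at_right_less[of "0::real"] by (rule eventually_mono) (use r in simp)
    ultimately show ?thesis unfolding filterlim_at by simp
  qed
  have l1: "filterlim (\<lambda>t. t / r) at_top at_top"
    using filterlim_tendsto_pos_mult_at_top[OF tendsto_const[of "1/r"] _ filterlim_ident] r by simp
  show ?thesis
    unfolding class_G_I_def
  proof (intro CollectI conjI allI impI ballI c)
    fix u :: 'a assume u: "u \<in> sphere 0 1"
    show "((\<lambda>t. G (t / r) u) \<longlongrightarrow> 0) (at_right 0)"
      by (rule filterlim_compose[OF _ l0]) (use G u in \<open>auto simp: class_G_I_def\<close>)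
    show "filterlim (\<lambda>t. G (t / r) u) at_top at_top"
      by (rule filterlim_compose[OF _ l1]) (use G u in \<open>auto simp: class_G_I_def\<close>)
    show "strict_mono_on {0<..} (\<lambda>t. G (t / r) u)"
      using u r by (intro strict_mono_onI class_G_I_dest(3)[OF G]) (simp_all add: divide_strict_right_mono)
    show "0 < G (t / r) u" if "0 < t" for t
      using u r that by (intro class_G_I_dest(2)[OF G]) auto
  qed
qed

lemma sphere_growth_rescale:
  assumes gr: "sphere_growth G" and r: "0 < r"
  shows "sphere_growth (\<lambda>t. G (t / r))"
proof -
  obtain c T where c: "0 < c" "0 < T" "\<And>t u. T \<le> t \<Longrightarrow> norm u = 1 \<Longrightarrow> c * t ^ (DIM('a) - 1) \<le> G t (u :: 'a)"
    using gr unfolding sphere_growth_def by blast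
  have "c / r ^ (DIM('a) - 1) * t ^ (DIM('a) - 1) \<le> G (t / r) u" if "T * r \<le> t" "norm u = 1" for t and u :: 'a
    using c(3)[of "t / r" u] that r by (simp add: power_divide field_simps)
  then show ?thesis
    unfolding sphere_growth_def using c r
    by (intro exI[of _ "c / r ^ (DIM('a) - 1)"] exI[of _ "T * r"] conjI) auto
qed

section \<open>A priori bounds and selection\<close>

lemma class_I_dest:
  assumes "\<phi> \<in> class_I"
  shows "continuous_on {0<..} \<phi>" and "0 < t \<Longrightarrow> 0 < \<phi> t"
    and "0 < s \<Longrightarrow> s < t \<Longrightarrow> \<phi> s < \<phi> t" and "0 < s \<Longrightarrow> s \<le> t \<Longrightarrow> \<phi> s \<le> \<phi> t"
    and "filterlim \<phi> at_top at_top"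
  using assms unfolding class_I_def strict_mono_on_def by (auto simp: order_le_less)

lemma integrable_class_I:
  fixes h :: "'a::euclidean_space \<Rightarrow> real"
  assumes "\<phi> \<in> class_I" and M: "finite_measure M" "sets M = sets (restrict_space borel (sphere 0 1))"
    and h: "continuous_on (sphere 0 1) h" "\<And>u. norm u = 1 \<Longrightarrow> 0 < h u"
  shows "integrable M (\<lambda>u. \<phi> (h u))"
proof (rule integrable_continuous_on_sphere[OF M])
  show "continuous_on (sphere 0 1) (\<lambda>u. \<phi> (h u))"
    by (rule continuous_on_compose2[OF class_I_dest(1)[OF assms(1)] h(1)]) (use h(2) in auto)
qed

text \<open>The function \<open>v \<mapsto> \<integral>max 0 (u \<bullet> v) d\<mu>\<close> is Lipschitz and positive, so it has a
  positive minimum on the sphere.\<close>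
lemma hemisphere_uniform_bound:
  fixes M :: "'a::euclidean_space measure"
  assumes fin: "finite_measure M" and M: "sets M = sets (restrict_space borel (sphere 0 1))"
    and hemi: "not_concentrated_on_closed_hemisphere M"
  obtains \<delta> m where "0 < \<delta>" "0 < m"
    "\<And>v. norm v = 1 \<Longrightarrow> m \<le> measure M (sphere 0 1 \<inter> {u. \<delta> \<le> u \<bullet> v})"
proof -
  interpret finite_measure M by fact
  have sp: "space M = sphere 0 1" using sets_eq_imp_space_eq[OF M] by (simp add: space_restrict_space)
  define W where "W v = (\<integral>u. max 0 (u \<bullet> v) \<partial>M)" for v
  have int: "integrable M (\<lambda>u. max 0 (u \<bullet> v))" for v
    by (intro integrable_continuous_on_sphere[OF fin M] continuous_intros)
  have lip: "W v \<le> W v' + measure M (space M) * norm (v - v')" for v v'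
  proof -
    have "W v \<le> (\<integral>u. max 0 (u \<bullet> v') + norm (v - v') \<partial>M)"
      unfolding W_def
    proof (rule integral_mono[OF int])
      fix u assume "u \<in> space M"
      then have "u \<bullet> (v - v') \<le> norm (v - v')" using norm_cauchy_schwarz[of u "v - v'"] by (simp add: sp)
      then show "max 0 (u \<bullet> v) \<le> max 0 (u \<bullet> v') + norm (v - v')" by (auto simp: inner_diff_right)
    qed (simp add: int)
    also have "\<dots> = W v' + measure M (space M) * norm (v - v')"
      unfolding W_def by (subst Bochner_Integration.integral_add) (auto simp: int)
    finally show ?thesis .
  qed
  have "(measure M (space M))-lipschitz_on UNIV W"
  proof (rule lipschitz_onI)
    show "dist (W x) (W y) \<le> measure M (space M) * dist x y" for x y
      using lip[of x y] lip[of y x] by (simp add: dist_norm norm_minus_commute abs_le_iff)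
  qed simp
  then have contW: "continuous_on (sphere 0 1) W"
    by (meson lipschitz_on_continuous_on continuous_on_subset subset_UNIV)
  have posW: "0 < W v" if v: "norm v = 1" for v
  proof -
    have pos: "0 < emeasure M {u \<in> sphere 0 1. u \<bullet> v > 0}"
      using hemi v by (simp add: not_concentrated_on_closed_hemisphere_def)
    have set: "{u \<in> sphere 0 1. u \<bullet> v > 0} \<in> sets M"
    proof -
      have "open {u. 0 < u \<bullet> v}" by (intro open_Collect_less continuous_intros)
      from sets_sphere_Int[OF M borel_open[OF this]] show ?thesis by (simp add: Int_def)
    qed
    have "W v \<noteq> 0"
    proof
      assume "W v = 0"
      then have "AE u in M. max 0 (u \<bullet> v) = 0"
        unfolding W_def by (subst (asm) integral_nonneg_eq_0_iff_AE[OF int]) auto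
      then have "AE u in M. u \<notin> {u \<in> sphere 0 1. u \<bullet> v > 0}" by (rule eventually_mono) auto
      then have "emeasure M {u \<in> sphere 0 1. u \<bullet> v > 0} = 0" using AE_iff_null_sets[OF set] by blast
      then show False using pos by simp
    qed
    moreover have "0 \<le> W v" unfolding W_def by (rule integral_nonneg_AE) auto
    ultimately show ?thesis by linarith
  qed
  have ne: "sphere (0::'a) 1 \<noteq> {}" by simp
  obtain v0 where v0: "v0 \<in> sphere 0 1" "\<And>v. v \<in> sphere 0 1 \<Longrightarrow> W v0 \<le> W v"
    using continuous_attains_inf[OF compact_sphere ne contW] by blast
  \<comment> \<open>The added 1 makes \<open>K\<close> positive. With \<open>\<delta>\<close> equal
    to half the minimum divided by \<open>K\<close>, the part of the integral where
    \<open>u \<bullet> v\<close> is below \<open>\<delta>\<close> accounts for at most half of the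
    minimum.\<close>
  define K where "K = measure M (space M) + 1"
  have K: "measure M (space M) \<le> K" "0 < K" unfolding K_def by (auto intro: add_nonneg_pos)
  have W0: "0 < W v0" using v0 posW by simp
  define \<delta> where "\<delta> = W v0 / (2 * K)"
  have \<delta>: "0 < \<delta>" "\<delta> * K = W v0 / 2" using W0 K by (auto simp: \<delta>_def)
  have "W v0 / 2 \<le> measure M (sphere 0 1 \<inter> {u. \<delta> \<le> u \<bullet> v})" if v: "norm v = 1" for v
  proof -
    let ?A = "sphere 0 1 \<inter> {u. \<delta> \<le> u \<bullet> v}"
    have A: "?A \<in> sets M"
      by (intro sets_sphere_Int[OF M] borel_closed closed_Collect_le continuous_intros)
    have "W v0 \<le> W v" using v v0 by simp
    \<comment> \<open>The integrand is at most 1 on \<open>?A\<close> and at most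
      \<open>\<delta>\<close> elsewhere.\<close>
    also have "\<dots> \<le> (\<integral>u. indicator ?A u + \<delta> \<partial>M)"
      unfolding W_def
    proof (rule integral_mono[OF int])
      show "integrable M (\<lambda>u. indicator ?A u + \<delta>)"
        using A by (intro Bochner_Integration.integrable_add) (auto simp: emeasure_eq_measure)
      fix u assume u: "u \<in> space M"
      then have "u \<bullet> v \<le> 1" using norm_cauchy_schwarz[of u v] v by (simp add: sp)
      then show "max 0 (u \<bullet> v) \<le> indicator ?A u + \<delta>"
        using u \<delta> by (auto simp: sp indicator_def)
    qed
    also have "\<dots> = measure M ?A + \<delta> * measure M (space M)"
      using A by (subst Bochner_Integration.integral_add) (auto simp: emeasure_eq_measure)
    also have "\<dots> \<le> measure M ?A + \<delta> * K" using K \<delta> by (intro add_left_mono mult_left_mono) auto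
    finally show ?thesis using \<delta>(2) by simp
  qed
  then show ?thesis using that[of \<delta> "W v0 / 2"] \<delta>(1) W0 by simp
qed

text \<open>A point \<open>x\<close> of the body far from the origin forces
  \<open>support_fun Q u \<ge> norm x * \<delta>\<close> on a set of mass at least \<open>m\<close>,
  with \<open>\<delta>\<close> and \<open>m\<close> independent of the direction of
  \<open>x\<close>; as \<open>\<phi>\<close> is unbounded, the integral would exceed
  \<open>L\<close>.\<close>

lemma Orlicz_sublevel_bounded:
  fixes M :: "'a::euclidean_space measure"
  assumes \<phi>: "\<phi> \<in> class_I" and fin: "finite_measure M" and M: "sets M = sets (restrict_space borel (sphere 0 1))"
    and hemi: "not_concentrated_on_closed_hemisphere M"
  obtains R where "0 < R"
    "\<And>Q u. Q \<in> convex_bodies_o \<Longrightarrow> (\<integral>u. \<phi> (support_fun Q u) \<partial>M) \<le> L \<Longrightarrow> support_fun Q u \<le> R * norm u"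
proof -
  interpret finite_measure M by fact
  have sp: "space M = sphere 0 1" using sets_eq_imp_space_eq[OF M] by (simp add: space_restrict_space)
  obtain \<delta> m where \<delta>: "0 < \<delta>" "0 < m" "\<And>v. norm v = 1 \<Longrightarrow> m \<le> measure M (sphere 0 1 \<inter> {u. \<delta> \<le> u \<bullet> v})"
    using hemisphere_uniform_bound[OF fin M hemi] by metis
  have "\<forall>\<^sub>F t in at_top. L / m < \<phi> t" using class_I_dest(5)[OF \<phi>] by (simp add: filterlim_at_top_dense)
  then obtain T where T: "\<And>t. T \<le> t \<Longrightarrow> L / m < \<phi> t" unfolding eventually_at_top_linorder by blast
  \<comment> \<open>Beyond \<open>T / \<delta>\<close> the product \<open>norm x * \<delta>\<close>
    passes the threshold at which \<open>\<phi>\<close> exceeds \<open>L / m\<close>; the maximum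
    with 1 keeps \<open>R\<close> positive whatever the sign of \<open>T\<close>.\<close>
  define R where "R = max 1 (T / \<delta>)"
  have bound: "norm x \<le> R" if Q: "Q \<in> convex_bodies_o" and L: "(\<integral>u. \<phi> (support_fun Q u) \<partial>M) \<le> L" and x: "x \<in> Q" for Q x
  proof (rule ccontr)
    assume "\<not> norm x \<le> R"
    then have nx: "R < norm x" by simp
    moreover have "1 \<le> R" by (simp add: R_def)
    ultimately have x0: "0 < norm x" by linarith
    define v where "v = x /\<^sub>R norm x"
    have v: "norm v = 1" "x = norm x *\<^sub>R v" using x0 by (auto simp: v_def)
    let ?A = "sphere 0 1 \<inter> {u. \<delta> \<le> u \<bullet> v}"
    have A: "?A \<in> sets M"
      by (intro sets_sphere_Int[OF M] borel_closed closed_Collect_le continuous_intros)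
    note h = positive_sublinear_support_fun[OF Q]
    have hpos: "0 < support_fun Q u" if "norm u = 1" for u
      using that by (intro positive_sublinearD(3)[OF h]) auto
    have "T / \<delta> \<le> norm x" using nx by (simp add: R_def)
    then have "T \<le> norm x * \<delta>" using \<delta>(1) by (simp add: field_simps)
    then have big: "L / m < \<phi> (norm x * \<delta>)" by (rule T)
    have \<phi>0: "0 < \<phi> (norm x * \<delta>)" using x0 \<delta> by (intro class_I_dest(2)[OF \<phi>]) simp
    have "L < \<phi> (norm x * \<delta>) * m" using big \<delta>(2) by (simp add: field_simps)
    also have "\<dots> \<le> \<phi> (norm x * \<delta>) * measure M ?A" using \<delta>(3)[OF v(1)] \<phi>0 by (intro mult_left_mono) auto
    also have "\<dots> = (\<integral>u. \<phi> (norm x * \<delta>) * indicator ?A u \<partial>M)" using A sets.sets_into_space[OF A]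
      by (simp add: Int_absorb1)
    also have "\<dots> \<le> (\<integral>u. \<phi> (support_fun Q u) \<partial>M)"
    proof (rule integral_mono)
      show "integrable M (\<lambda>u. \<phi> (norm x * \<delta>) * indicator ?A u)"
        using A by (intro integrable_mult_right integrable_real_indicator) (auto simp: emeasure_eq_measure)
      show "integrable M (\<lambda>u. \<phi> (support_fun Q u))"
        by (intro integrable_class_I[OF \<phi> fin M] positive_sublinear_continuous[OF h] hpos)
      fix u assume "u \<in> space M"
      then have u: "norm u = 1" by (simp add: sp)
      show "\<phi> (norm x * \<delta>) * indicator ?A u \<le> \<phi> (support_fun Q u)"
      proof (cases "u \<in> ?A")
        case True
        have "norm x * \<delta> \<le> norm x * (u \<bullet> v)" using True x0 by (intro mult_left_mono) auto
        also have "\<dots> = x \<bullet> u" by (subst (2) v(2)) (simp add: inner_commute)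
        also have "\<dots> \<le> support_fun Q u" by (rule inner_le_support_fun[OF convex_bodies_oD(3)[OF Q] x])
        finally show ?thesis using True x0 \<delta>(1) by (auto intro!: class_I_dest(4)[OF \<phi>])
      qed (use class_I_dest(2)[OF \<phi> hpos[OF u]] in auto)
    qed
    finally show False using L by simp
  qed
  have "support_fun Q u \<le> R * norm u"
    if Q: "Q \<in> convex_bodies_o" and "(\<integral>u. \<phi> (support_fun Q u) \<partial>M) \<le> L" for Q u
  proof (intro support_fun_le convex_bodies_oD(6)[OF Q])
    fix x assume "x \<in> Q"
    have "x \<bullet> u \<le> norm x * norm u" by (rule norm_cauchy_schwarz)
    also have "\<dots> \<le> R * norm u" using bound[OF that \<open>x \<in> Q\<close>] by (intro mult_right_mono) auto
    finally show "x \<bullet> u \<le> R * norm u" .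
  qed
  then show ?thesis using that[of R] by (auto simp: R_def)
qed

lemma positive_sublinear_lipschitz:
  assumes h: "positive_sublinear h" and R: "\<And>u. h u \<le> R * norm u"
  shows "\<bar>h x - h y\<bar> \<le> R * norm (x - y)"
proof -
  have "h x \<le> h y + R * norm (x - y)" for x y
    using positive_sublinearD(1)[OF h, of y "x - y"] R[of "x - y"] by simp
  from this[of x y] this[of y x] show ?thesis by (simp add: norm_minus_commute abs_le_iff)
qed

text \<open>A substitute for Blaschke's selection theorem.\<close>
lemma sublinear_selection:
  fixes hn :: "nat \<Rightarrow> 'a::euclidean_space \<Rightarrow> real"
  assumes hn: "\<And>n. positive_sublinear (hn n)" and R: "\<And>n u. hn n u \<le> R * norm u"
  obtains h k where "strict_mono (k :: nat \<Rightarrow> nat)"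
    "\<And>u. (\<lambda>n. hn (k n) u) \<longlonglongrightarrow> h u"
    "\<And>e. 0 < e \<Longrightarrow> \<forall>\<^sub>F n in sequentially. \<forall>u. norm u = 1 \<longrightarrow> \<bar>hn (k n) u - h u\<bar> < e"
    "\<And>u v. h (u + v) \<le> h u + h v" "\<And>c u. 0 \<le> c \<Longrightarrow> h (c *\<^sub>R u) = c * h u"
    "\<And>u. 0 \<le> h u" "\<And>u. h u \<le> R * norm u"
proof -
  have nonneg: "0 \<le> hn n u" for n u
    using positive_sublinearD(3)[OF hn, of u n] positive_sublinear_zero[OF hn, of n] by (cases "u = 0") auto
  obtain g k where gk: "continuous_on (sphere 0 1) g" "strict_mono (k :: nat \<Rightarrow> nat)"
    "\<And>e. 0 < e \<Longrightarrow> \<exists>N. \<forall>n x. n \<ge> N \<and> x \<in> sphere 0 1 \<longrightarrow> norm (hn (k n) x - g x) < e"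
  proof (rule Arzela_Ascoli[of "sphere 0 1" hn R])
    show "norm (hn n x) \<le> R" if "x \<in> sphere 0 1" for n x
      using R[of n x] nonneg[of n x] that by simp
    show "\<exists>d>0. \<forall>n y. y \<in> sphere 0 1 \<and> norm (x - y) < d \<longrightarrow> norm (hn n x - hn n y) < e"
      if "x \<in> sphere 0 1" "0 < e" for x e
    proof (intro exI[of _ "e / (\<bar>R\<bar> + 1)"] conjI allI impI)
      show "0 < e / (\<bar>R\<bar> + 1)" using that by simp
      fix n y assume y: "y \<in> sphere 0 1 \<and> norm (x - y) < e / (\<bar>R\<bar> + 1)"
      have "\<bar>hn n x - hn n y\<bar> \<le> R * norm (x - y)" by (rule positive_sublinear_lipschitz[OF hn R])
      also have "\<dots> \<le> (\<bar>R\<bar> + 1) * norm (x - y)" by (intro mult_right_mono) auto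
      also have "\<dots> < e" using y by (simp add: field_simps)
      finally show "norm (hn n x - hn n y) < e" by simp
    qed
  qed (use that in auto)
  \<comment> \<open>Arzela-Ascoli yields a limit on the sphere only; this is its 1-homogeneous
    extension, with value 0 at the origin.\<close>
  define h where "h u = norm u * g (u /\<^sub>R norm u)" for u
  have hg: "h u = g u" if "norm u = 1" for u using that by (simp add: h_def)
  have lim_g: "(\<lambda>n. hn (k n) u) \<longlonglongrightarrow> g u" if "norm u = 1" for u
    unfolding LIMSEQ_iff using gk(3) that by (metis mem_sphere_0)
  have lim: "(\<lambda>n. hn (k n) u) \<longlonglongrightarrow> h u" for u
  proof (cases "u = 0")
    case True
    then show ?thesis by (simp add: h_def positive_sublinear_zero[OF hn])
  next
    case False
    have "hn n u = norm u * hn n (u /\<^sub>R norm u)" for n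
      using False positive_sublinearD(2)[OF hn, of "norm u" n "u /\<^sub>R norm u"] by simp
    moreover have "(\<lambda>n. norm u * hn (k n) (u /\<^sub>R norm u)) \<longlonglongrightarrow> norm u * g (u /\<^sub>R norm u)"
      using False by (intro tendsto_intros lim_g) simp
    ultimately show ?thesis by (simp add: h_def)
  qed
  show ?thesis
  proof (rule that[of k h])
    show "\<forall>\<^sub>F n in sequentially. \<forall>u. norm u = 1 \<longrightarrow> \<bar>hn (k n) u - h u\<bar> < e" if e: "0 < e" for e
      unfolding eventually_sequentially using gk(3)[OF e] by (auto simp: hg)
    show "h (u + v) \<le> h u + h v" for u v
      by (rule LIMSEQ_le[OF lim tendsto_add[OF lim lim]]) (auto intro: positive_sublinearD(1)[OF hn])
    show "h (c *\<^sub>R u) = c * h u" if c: "0 \<le> c" for c u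
      by (rule LIMSEQ_unique[OF lim]) (use tendsto_mult_left[OF lim, of c u] positive_sublinearD(2)[OF hn c] in simp)
    show "0 \<le> h u" for u by (rule LIMSEQ_le_const[OF lim]) (use nonneg in auto)
    show "h u \<le> R * norm u" for u by (rule LIMSEQ_le_const2[OF lim]) (use R in auto)
  qed (use gk lim in auto)
qed

text \<open>If the limit vanished at \<open>v\<close>, then it would be at most \<open>R \<bar>u - v\<bar>\<close>, and by Fatou's lemma
  the volumes would dominate a divergent integral.\<close>
lemma sphere_vol_limit_positive:
  fixes hn :: "nat \<Rightarrow> 'a::euclidean_space \<Rightarrow> real"
  assumes dim: "2 \<le> DIM('a)" and G: "G \<in> class_G_I" and gr: "sphere_growth G"
    and hn: "\<And>n. positive_sublinear (hn n)" and vol: "\<And>n. sphere_vol G (hn n) = a"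
    and lim: "\<And>u. (\<lambda>n. hn n u) \<longlonglongrightarrow> h u"
    and h: "\<And>u v. h (u + v) \<le> h u + h v" "\<And>u. h u \<le> R * norm u" and R: "0 < R" and v: "norm v = 1"
  shows "0 < h v"
proof (rule ccontr)
  assume "\<not> 0 < h v"
  then have hv: "h v \<le> 0" by simp
  let ?S = "spherical_measure :: 'a measure"
  obtain c T where c: "0 < c" "0 < T" "\<And>t u. T \<le> t \<Longrightarrow> norm u = 1 \<Longrightarrow> c * t ^ (DIM('a) - 1) \<le> G t (u :: 'a)"
    using gr unfolding sphere_growth_def by blast
  have pos: "0 < hn n u" if "norm u = 1" for n u
    using that by (intro positive_sublinearD(3)[OF hn]) auto
  have cont: "continuous_on (sphere 0 1) (\<lambda>u. G (1 / hn n u) u)" for n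
    by (intro class_G_I_continuous[OF G] positive_sublinear_continuous[OF hn] pos)
  have int: "integrable ?S (\<lambda>u. G (1 / hn n u) u)" for n
    by (intro integrable_continuous_on_sphere finite_measure_spherical_measure sets_spherical_measure cont)
  define f where "f n u = ennreal (G (1 / hn n u) u)" for n u
  have meas: "f n \<in> borel_measurable ?S" for n
    unfolding f_def using int[of n] by auto
  have nn: "(\<integral>\<^sup>+u. f n u \<partial>?S) = ennreal a" for n
  proof -
    have "0 \<le> G (1 / hn n u) u" if "u \<in> space ?S" for u
      using that pos[of u n] by (intro less_imp_le class_G_I_dest(2)[OF G]) auto
    then show ?thesis
      unfolding f_def vol[of n, symmetric] sphere_vol_def by (intro nn_integral_eq_integral int AE_I2)
  qed
  have "(\<integral>\<^sup>+u. liminf (\<lambda>n. f n u) \<partial>?S) = top"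
  proof (rule nn_integral_singularity_eq_top[OF dim v])
    show "(\<lambda>u. liminf (\<lambda>n. f n u)) \<in> borel_measurable ?S" using meas by simp
    show "0 < c / (2 * R) ^ (DIM('a) - 1)" using c R by simp
    show "0 < 1 / (2 * R * T)" using c R by simp
    fix u :: 'a assume u: "norm u = 1" "0 < dist v u" "dist v u < 1 / (2 * R * T)"
    \<comment> \<open>The factor 2 creates room: \<open>h u\<close> is at most
      \<open>R * dist v u\<close>, which is strictly below \<open>1 / t\<close>, so
      \<open>hn n u < 1 / t\<close> holds eventually. The radius \<open>1 / (2 * R * T)\<close>
      ensures that \<open>t\<close> has reached the growth threshold.\<close>
    define t where "t = 1 / (2 * R * dist v u)"
    have t: "0 < t" "T \<le> t" using u R c by (auto simp: t_def field_simps)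
    have "h u \<le> R * norm (u - v)" using h(1)[of v "u - v"] h(2)[of "u - v"] hv by simp
    also have "\<dots> < 1 / t" using u(2) R by (simp add: t_def dist_norm norm_minus_commute)
    finally have "\<forall>\<^sub>F n in sequentially. hn n u < 1 / t" by (rule order_tendstoD(2)[OF lim])
    then have "\<forall>\<^sub>F n in sequentially. ennreal (c * t ^ (DIM('a) - 1)) \<le> f n u"
    proof (rule eventually_mono)
      fix n assume n: "hn n u < 1 / t"
      have "c * t ^ (DIM('a) - 1) \<le> G t u" using t u by (intro c)
      also have "\<dots> \<le> G (1 / hn n u) u"
        using n t pos[OF u(1), of n] by (intro class_G_I_dest(4)[OF G _ _ u(1)]) (auto simp: field_simps)
      finally show "ennreal (c * t ^ (DIM('a) - 1)) \<le> f n u" unfolding f_def by (rule ennreal_leI)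
    qed
    then have "ennreal (c * t ^ (DIM('a) - 1)) \<le> liminf (\<lambda>n. f n u)" by (rule Liminf_bounded)
    then show "ennreal (c / (2 * R) ^ (DIM('a) - 1) / dist v u ^ (DIM('a) - 1)) \<le> liminf (\<lambda>n. f n u)"
      by (simp add: t_def power_divide power_mult_distrib)
  qed
  moreover have "(\<integral>\<^sup>+u. liminf (\<lambda>n. f n u) \<partial>?S) \<le> liminf (\<lambda>n. \<integral>\<^sup>+u. f n u \<partial>?S)"
    by (rule nn_integral_liminf[OF meas])
  ultimately show False by (simp add: nn Liminf_const top_unique)
qed

section \<open>Minimizers\<close>

definition Orlicz_inf :: "(real \<Rightarrow> real) \<Rightarrow> 'a::euclidean_space measure \<Rightarrow> (real \<Rightarrow> 'a \<Rightarrow> real) \<Rightarrow> real" where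
  "Orlicz_inf \<phi> M G = (INF Q\<in>B_tilde G. \<integral>u. \<phi> (support_fun Q u) \<partial>M)"

text \<open>The ball is its own polar. Its membership makes the class nonempty, so that the real
  infimum over it can be approached by a sequence.\<close>

lemma cball_in_B_tilde: "cball 0 1 \<in> B_tilde (G :: real \<Rightarrow> 'a::euclidean_space \<Rightarrow> real)"
proof -
  have cb: "cball (0::'a) 1 \<in> convex_bodies_o" by (simp add: convex_bodies_o_def)
  have polar: "polar_body (cball (0::'a) 1) = cball 0 1"
  proof (intro equalityI subsetI)
    fix x :: 'a assume x: "x \<in> polar_body (cball 0 1)"
    show "x \<in> cball 0 1"
    proof (cases "x = 0")
      case False
      then have "x /\<^sub>R norm x \<in> cball 0 1" by simp
      then have "x \<bullet> (x /\<^sub>R norm x) \<le> 1" using x unfolding polar_body_def by blast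
      moreover have "x \<bullet> (x /\<^sub>R norm x) = norm x"
        using False by (simp add: power2_norm_eq_inner[symmetric] power2_eq_square)
      ultimately show ?thesis by simp
    qed simp
  next
    fix x :: 'a assume x: "x \<in> cball 0 1"
    have "x \<bullet> y \<le> 1" if "norm y \<le> 1" for y
      using norm_cauchy_schwarz[of x y] mult_mono[of "norm x" 1 "norm y" 1] x that by simp
    then show "x \<in> polar_body (cball 0 1)" by (simp add: polar_body_def)
  qed
  show ?thesis by (simp add: B_tilde_def cb polar)
qed

lemma Orlicz_inf_le:
  assumes \<phi>: "\<phi> \<in> class_I" and M: "sets M = sets (restrict_space borel (sphere (0::'a::euclidean_space) 1))"
    and Q: "Q \<in> B_tilde G"
  shows "Orlicz_inf \<phi> M G \<le> (\<integral>u. \<phi> (support_fun Q u) \<partial>M)"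
  unfolding Orlicz_inf_def
proof (rule cINF_lower[OF _ Q])
  have sp: "space M = sphere 0 1" using sets_eq_imp_space_eq[OF M] by (simp add: space_restrict_space)
  have "0 \<le> (\<integral>u. \<phi> (support_fun Q u) \<partial>M)" if "Q \<in> B_tilde G" for Q
  proof (rule integral_nonneg_AE[OF AE_I2])
    fix u assume "u \<in> space M"
    then have "0 < support_fun Q u"
      using that by (intro positive_sublinearD(3)[OF positive_sublinear_support_fun]) (auto simp: sp B_tilde_def)
    then show "0 \<le> \<phi> (support_fun Q u)" by (intro less_imp_le class_I_dest(2)[OF \<phi>])
  qed
  then show "bdd_below ((\<lambda>Q. \<integral>u. \<phi> (support_fun Q u) \<partial>M) ` B_tilde G)"
    by (intro bdd_belowI2)
qed

lemma Orlicz_minimizer_exists: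
  fixes M :: "'a::euclidean_space measure"
  assumes dim: "2 \<le> DIM('a)" and \<phi>: "\<phi> \<in> class_I" and fin: "finite_measure M"
    and M: "sets M = sets (restrict_space borel (sphere 0 1))"
    and hemi: "not_concentrated_on_closed_hemisphere M"
    and G: "G \<in> class_G_I" and gr: "sphere_growth G"
  shows "\<exists>Q\<in>B_tilde G. (\<integral>u. \<phi> (support_fun Q u) \<partial>M) = Orlicz_inf \<phi> M G"
proof -
  let ?I = "\<lambda>h. \<integral>u. \<phi> (h u) \<partial>M" and ?m = "Orlicz_inf \<phi> M G"
  have "\<exists>Q. Q \<in> B_tilde G \<and> ?I (support_fun Q) < ?m + 1 / real (Suc n)" for n
  proof -
    have "\<exists>x\<in>(\<lambda>Q. ?I (support_fun Q)) ` B_tilde G. x < ?m + 1 / real (Suc n)"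
      by (rule cInf_lessD) (use cball_in_B_tilde in \<open>auto simp: Orlicz_inf_def\<close>)
    then show ?thesis by blast
  qed
  then obtain Qn where Qn: "\<And>n. Qn n \<in> B_tilde G" "\<And>n. ?I (support_fun (Qn n)) < ?m + 1 / real (Suc n)"
    by metis
  have Qb: "Qn n \<in> convex_bodies_o" for n using Qn(1) by (simp add: B_tilde_iff)
  define hn where "hn n = support_fun (Qn n)" for n
  have hn: "positive_sublinear (hn n)" for n unfolding hn_def by (rule positive_sublinear_support_fun[OF Qb])
  have vol: "sphere_vol G (hn n) = sphere_vol G norm" for n using Qn(1)[of n] by (simp add: B_tilde_iff hn_def)
  have I_lim: "(\<lambda>n. ?I (hn n)) \<longlonglongrightarrow> ?m"
  proof (rule tendsto_sandwich)
    show "\<forall>\<^sub>F n in sequentially. ?m \<le> ?I (hn n)"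
      unfolding hn_def using Orlicz_inf_le[OF \<phi> M Qn(1)] by simp
    show "\<forall>\<^sub>F n in sequentially. ?I (hn n) \<le> ?m + inverse (real (Suc n))"
      unfolding hn_def using Qn(2) by (intro always_eventually allI) (simp add: inverse_eq_divide less_imp_le del: of_nat_Suc)
    show "(\<lambda>n. ?m + inverse (real (Suc n))) \<longlonglongrightarrow> ?m"
      using tendsto_add[OF tendsto_const[of ?m] LIMSEQ_inverse_real_of_nat] by simp
  qed simp
  \<comment> \<open>All integrals along the minimizing sequence stay below \<open>?m + 1\<close>, so
    a single sublevel set contains it.\<close>
  obtain R where R: "0 < R"
    "\<And>Q u. Q \<in> convex_bodies_o \<Longrightarrow> ?I (support_fun Q) \<le> ?m + 1 \<Longrightarrow> support_fun Q u \<le> R * norm u"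
    using Orlicz_sublevel_bounded[OF \<phi> fin M hemi] by metis
  have hnR: "hn n u \<le> R * norm u" for n u
  proof -
    have "1 / real (Suc n) \<le> 1" by simp
    then show ?thesis unfolding hn_def using Qn(2)[of n] by (intro R(2) Qb) linarith
  qed
  obtain h k where k: "strict_mono (k :: nat \<Rightarrow> nat)"
    and lim: "\<And>u. (\<lambda>n. hn (k n) u) \<longlonglongrightarrow> h u"
    and unif: "\<And>e. 0 < e \<Longrightarrow> \<forall>\<^sub>F n in sequentially. \<forall>u. norm u = 1 \<longrightarrow> \<bar>hn (k n) u - h u\<bar> < e"
    and h: "\<And>u v. h (u + v) \<le> h u + h v" "\<And>c u. 0 \<le> c \<Longrightarrow> h (c *\<^sub>R u) = c * h u" "\<And>u. 0 \<le> h u"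
      "\<And>u. h u \<le> R * norm u"
    by (rule sublinear_selection[of hn R, OF hn hnR]) blast
  \<comment> \<open>The measure bounds the bodies only from outside; it is the volume constraint
    that keeps the limit from degenerating.\<close>
  have h1: "0 < h v" if "norm v = 1" for v
    by (rule sphere_vol_limit_positive[OF dim G gr hn vol lim h(1,4) R(1) that])
  have "0 < h u" if "u \<noteq> 0" for u
    using h1[of "u /\<^sub>R norm u"] h(2)[of "norm u" "u /\<^sub>R norm u"] that by simp
  then have hs: "positive_sublinear h" using h(1,2) by (simp add: positive_sublinear_def)
  obtain e where e: "0 < e" "\<And>u. e * norm u \<le> h u"
    using positive_sublinear_bounds[OF hs] by metis
  obtain N where N: "\<And>n u. N \<le> n \<Longrightarrow> norm u = 1 \<Longrightarrow> \<bar>hn (k n) u - h u\<bar> < e / 2"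
    using unif[of "e / 2"] e(1) unfolding eventually_sequentially by auto
  \<comment> \<open>From index \<open>N\<close> on, uniform convergence keeps the functions above
    \<open>e / 2\<close> on the sphere. Dropping the earlier terms supplies the fixed interval that
    bounded convergence needs.\<close>
  define j where "j n = k (n + N)" for n
  have j: "filterlim j sequentially sequentially"
    unfolding j_def using filterlim_compose[OF filterlim_subseq[OF k] filterlim_add_const_nat_at_top] by simp
  have lim_j: "(\<lambda>n. hn (j n) u) \<longlonglongrightarrow> h u" for u
    unfolding j_def by (rule LIMSEQ_ignore_initial_segment[OF lim])
  have bounds: "e / 2 \<le> hn (j n) u \<and> hn (j n) u \<le> R" if u: "norm u = 1" for n u
  proof
    have "\<bar>hn (j n) u - h u\<bar> < e / 2" unfolding j_def by (rule N) (use u in auto)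
    then show "e / 2 \<le> hn (j n) u" using e(2)[of u] u unfolding abs_less_iff by simp
    show "hn (j n) u \<le> R" using hnR[of "j n" u] u by simp
  qed
  have cont: "continuous_on (sphere 0 1) (hn n)" "continuous_on (sphere 0 1) h" for n
    by (rule positive_sublinear_continuous[OF hn], rule positive_sublinear_continuous[OF hs])
  have e2: "0 < e / 2" using e by simp
  have "(\<lambda>n. sphere_vol G (hn (j n))) \<longlonglongrightarrow> sphere_vol G h"
    by (rule sphere_vol_convergence[OF G cont e2 bounds lim_j])
  then have vol_h: "sphere_vol G h = sphere_vol G norm"
    by (simp add: vol LIMSEQ_const_iff)
  have c\<phi>: "continuous_on ({0<..} \<times> sphere 0 1) (\<lambda>(t, u::'a). \<phi> t)"
  proof -
    have "continuous_on ({0<..} \<times> sphere (0::'a) 1) (\<lambda>x. \<phi> (fst x))"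
      by (rule continuous_on_compose2[OF class_I_dest(1)[OF \<phi>]]) (auto intro!: continuous_intros)
    then show ?thesis by (simp add: split_beta)
  qed
  have "(\<lambda>n. ?I (hn (j n))) \<longlonglongrightarrow> ?I h"
    by (rule integral_sphere_bounded_convergence[where H = "\<lambda>t u. \<phi> t", OF fin M c\<phi> cont e2 bounds lim_j])
  then have I_h: "?I h = ?m"
    by (rule LIMSEQ_unique) (rule filterlim_compose[OF I_lim j])
  obtain Q where Q: "Q \<in> convex_bodies_o" "support_fun Q = h"
    using positive_sublinear_is_support_fun[OF hs] by metis
  then have "Q \<in> B_tilde G" by (simp add: B_tilde_iff vol_h)
  then show ?thesis using Q I_h by blast
qed

section \<open>Uniqueness\<close>

lemma inverse_strict_convex:
  fixes a b :: real
  assumes "0 < a" "0 < b"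
  shows "1 / ((a + b) / 2) \<le> (1 / a + 1 / b) / 2" "a \<noteq> b \<Longrightarrow> 1 / ((a + b) / 2) < (1 / a + 1 / b) / 2"
proof -
  have eq: "(1 / a + 1 / b) / 2 - 1 / ((a + b) / 2) = (a - b)\<^sup>2 / (2 * a * b * (a + b))"
    using assms by (simp add: field_simps power2_eq_square add_pos_pos less_imp_neq[symmetric])
  have "0 < 2 * a * b * (a + b)" using assms by simp
  then have "0 \<le> (a - b)\<^sup>2 / (2 * a * b * (a + b))" "a \<noteq> b \<Longrightarrow> 0 < (a - b)\<^sup>2 / (2 * a * b * (a + b))" by auto
  then show "1 / ((a + b) / 2) \<le> (1 / a + 1 / b) / 2" "a \<noteq> b \<Longrightarrow> 1 / ((a + b) / 2) < (1 / a + 1 / b) / 2"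
    unfolding eq[symmetric] by auto
qed

lemma convex_on_midpoint:
  fixes f :: "real \<Rightarrow> real"
  assumes "convex_on S f" "x \<in> S" "y \<in> S"
  shows "f ((x + y) / 2) \<le> (f x + f y) / 2"
  using convex_onD[OF assms(1), of "1/2" x y] assms(2,3) by (simp add: add_divide_distrib)

text \<open>The average of two minimizers has smaller volume because \<open>t \<mapsto> 1 / t\<close> is strictly
  convex; shrinking the average until the constraint holds again strictly lowers the Orlicz
  integral.\<close>
lemma Orlicz_minimizer_unique:
  fixes M :: "'a::euclidean_space measure"
  assumes dim: "2 \<le> DIM('a)" and \<phi>: "\<phi> \<in> class_I" and fin: "finite_measure M"
    and M: "sets M = sets (restrict_space borel (sphere 0 1))" and nz: "emeasure M (space M) \<noteq> 0"
    and G: "G \<in> class_G_I" and gr: "sphere_growth G"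
    and conv: "convex_on {0<..} \<phi>" "\<And>u. u \<in> sphere 0 1 \<Longrightarrow> convex_on {0<..} (\<lambda>t. G t u)"
    and Q1: "Q1 \<in> B_tilde G" "(\<integral>u. \<phi> (support_fun Q1 u) \<partial>M) = Orlicz_inf \<phi> M G"
    and Q2: "Q2 \<in> B_tilde G" "(\<integral>u. \<phi> (support_fun Q2 u) \<partial>M) = Orlicz_inf \<phi> M G"
  shows "Q1 = Q2"
proof (rule ccontr)
  assume ne: "Q1 \<noteq> Q2"
  interpret finite_measure M by fact
  let ?m = "Orlicz_inf \<phi> M G" and ?a = "sphere_vol G (norm :: 'a \<Rightarrow> real)"
  have sp: "space M = sphere 0 1" using sets_eq_imp_space_eq[OF M] by (simp add: space_restrict_space)
  define h1 where "h1 = support_fun Q1"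
  define h2 where "h2 = support_fun Q2"
  have b: "Q1 \<in> convex_bodies_o" "Q2 \<in> convex_bodies_o" using Q1 Q2 by (auto simp: B_tilde_iff)
  have s1: "positive_sublinear h1" and s2: "positive_sublinear h2"
    unfolding h1_def h2_def using b by (auto intro: positive_sublinear_support_fun)
  have vol: "sphere_vol G h1 = ?a" "sphere_vol G h2 = ?a"
    using Q1(1) Q2(1) by (auto simp: B_tilde_iff h1_def h2_def)
  define h0 where "h0 u = 1/2 * (h1 u + h2 u)" for u
  have s0: "positive_sublinear h0"
    unfolding h0_def by (intro positive_sublinear_scale positive_sublinear_add s1 s2) simp
  note cont = positive_sublinear_continuous[OF s0] positive_sublinear_continuous[OF s1] positive_sublinear_continuous[OF s2]
  have pos: "0 < h0 u" "0 < h1 u" "0 < h2 u" if "norm u = 1" for u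
    using that by (auto intro!: positive_sublinearD(3)[OF s0] positive_sublinearD(3)[OF s1] positive_sublinearD(3)[OF s2])
  have int\<phi>: "integrable M (\<lambda>u. \<phi> (h u))" if "positive_sublinear h" for h
  proof (intro integrable_class_I[OF \<phi> fin M] positive_sublinear_continuous[OF that])
    show "0 < h u" if "norm u = 1" for u
      using that by (intro positive_sublinearD(3)[OF \<open>positive_sublinear h\<close>]) auto
  qed
  note contG = class_G_I_continuous[OF G cont(1) pos(1)] class_G_I_continuous[OF G cont(2) pos(2)]
    class_G_I_continuous[OF G cont(3) pos(3)]
  note intG = integrable_continuous_on_sphere[OF finite_measure_spherical_measure sets_spherical_measure contG(2)]
    integrable_continuous_on_sphere[OF finite_measure_spherical_measure sets_spherical_measure contG(3)]
  have mid: "G ((1 / h1 u + 1 / h2 u) / 2) u \<le> (G (1 / h1 u) u + G (1 / h2 u) u) / 2" if u: "norm u = 1" for u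
    using pos[OF u] u by (intro convex_on_midpoint[OF conv(2)]) auto
  have h0_eq: "1 / h0 u = 1 / ((h1 u + h2 u) / 2)" for u by (simp add: h0_def)
  obtain v where v: "norm v = 1" "h1 v \<noteq> h2 v"
    using convex_body_eqI[OF b] ne unfolding h1_def h2_def by blast
  have "sphere_vol G h0 < (\<integral>u. (G (1 / h1 u) u + G (1 / h2 u) u) / 2 \<partial>spherical_measure)"
    unfolding sphere_vol_def
  proof (rule integral_spherical_strict_mono[OF contG(1) _ _ v(1)])
    show "continuous_on (sphere 0 1) (\<lambda>u. (G (1 / h1 u) u + G (1 / h2 u) u) / 2)"
      by (intro continuous_intros contG) auto
    show "G (1 / h0 u) u \<le> (G (1 / h1 u) u + G (1 / h2 u) u) / 2" if u: "norm u = 1" for u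
    proof -
      have "G (1 / h0 u) u \<le> G ((1 / h1 u + 1 / h2 u) / 2) u"
        using pos[OF u] inverse_strict_convex(1)[OF pos(2,3)[OF u]] unfolding h0_eq[symmetric]
        by (intro class_G_I_dest(4)[OF G _ _ u]) auto
      with mid[OF u] show ?thesis by linarith
    qed
    have "G (1 / h0 v) v < G ((1 / h1 v + 1 / h2 v) / 2) v"
      using pos[OF v(1)] inverse_strict_convex(2)[OF pos(2,3)[OF v(1)] v(2)] unfolding h0_eq[symmetric]
      by (intro class_G_I_dest(3)[OF G _ _ v(1)]) auto
    with mid[OF v(1)] show "G (1 / h0 v) v < (G (1 / h1 v) v + G (1 / h2 v) v) / 2" by linarith
  qed
  also have "\<dots> = (sphere_vol G h1 + sphere_vol G h2) / 2"
    using intG by (simp add: sphere_vol_def)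
  finally have less: "sphere_vol G h0 < ?a" by (simp add: vol)
  \<comment> \<open>The existence of a scale needs a positive target value, here
    \<open>?a\<close>.\<close>
  have "0 < sphere_vol G h0"
  proof -
    have "(\<integral>u. 0 \<partial>(spherical_measure :: 'a measure)) < sphere_vol G h0"
      unfolding sphere_vol_def
    proof (rule integral_spherical_strict_mono[OF _ contG(1) _ v(1)])
      have G0: "0 < G (1 / h0 u) u" if u: "norm u = 1" for u
        using pos(1)[OF u] by (intro class_G_I_dest(2)[OF G _ u]) simp
      show "0 \<le> G (1 / h0 u) u" if u: "norm u = 1" for u using G0[OF u] by simp
      show "0 < G (1 / h0 v) v" by (rule G0[OF v(1)])
    qed simp
    then show ?thesis by simp
  qed
  then have "0 < ?a" using less by linarith
  then obtain r where r: "0 < r" "sphere_vol G (\<lambda>u. r * h0 u) = ?a"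
    using sphere_vol_scale_exists[OF dim G gr cont(1) pos(1)] by metis
  \<comment> \<open>Enlarging \<open>h0\<close> lowers the volume, which already lies below the
    target; only a factor below 1 can raise it to \<open>?a\<close>.\<close>
  have "r < 1"
  proof (rule ccontr)
    assume "\<not> r < 1"
    then consider "r = 1" | "1 < r" by linarith
    then have "sphere_vol G (\<lambda>u. r * h0 u) \<le> sphere_vol G h0"
    proof cases
      case 2
      then show ?thesis
        by (intro less_imp_le sphere_vol_strict_antimono[OF G cont(1) pos(1)] continuous_intros cont) (auto simp: pos(1))
    qed simp
    then show False using less r by simp
  qed
  have sr: "positive_sublinear (\<lambda>u. r * h0 u)" by (rule positive_sublinear_scale[OF s0 r(1)])
  obtain Q where Q: "Q \<in> convex_bodies_o" "support_fun Q = (\<lambda>u. r * h0 u)"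
    using positive_sublinear_is_support_fun[OF sr] by metis
  then have "Q \<in> B_tilde G" using r by (simp add: B_tilde_iff)
  then have "?m \<le> (\<integral>u. \<phi> (r * h0 u) \<partial>M)" using Orlicz_inf_le[OF \<phi> M, of Q G] Q(2) by simp
  \<comment> \<open>The integrands differ strictly at every point of the sphere, so integration over
    a nonzero measure keeps the inequality strict.\<close>
  also have "\<dots> < (\<integral>u. \<phi> (h0 u) \<partial>M)"
  proof (rule integral_less_AE_space[OF int\<phi>[OF sr] int\<phi>[OF s0] _ nz])
    show "AE u in M. \<phi> (r * h0 u) < \<phi> (h0 u)"
      using pos r \<open>r < 1\<close> by (intro AE_I2 class_I_dest(3)[OF \<phi>]) (auto simp: sp)
  qed
  also have "\<dots> \<le> (\<integral>u. (\<phi> (h1 u) + \<phi> (h2 u)) / 2 \<partial>M)"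
  proof (rule integral_mono[OF int\<phi>[OF s0]])
    show "integrable M (\<lambda>u. (\<phi> (h1 u) + \<phi> (h2 u)) / 2)"
      using int\<phi>[OF s1] int\<phi>[OF s2] by simp
    fix u assume "u \<in> space M"
    then have u: "norm u = 1" by (simp add: sp)
    show "\<phi> (h0 u) \<le> (\<phi> (h1 u) + \<phi> (h2 u)) / 2"
      using convex_on_midpoint[OF conv(1), of "h1 u" "h2 u"] pos[OF u] by (simp add: h0_def)
  qed
  also have "\<dots> = ?m"
    using int\<phi>[OF s1] int\<phi>[OF s2] Q1(2) Q2(2) by (simp add: h1_def h2_def)
  finally show False by simp
qed

section \<open>The growth hypothesis and the two problems together\<close>

text \<open>A real infimum is a lower bound only for a set bounded below, which positivity of
  \<open>G\<close> guarantees. For \<open>t \<ge> 1\<close> powers increase with the exponent, so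
  \<open>q\<close> may be lowered to n - 1.\<close>

lemma sphere_growth_of_INF:
  fixes G :: "real \<Rightarrow> 'a::euclidean_space \<Rightarrow> real"
  assumes G: "G \<in> class_G_I" and q: "real DIM('a) - 1 \<le> q"
    and INF: "0 < (INF (t, u)\<in>{1..} \<times> sphere 0 1. G t u / t powr q)"
  shows "sphere_growth G"
proof -
  define c where "c = (INF (t, u)\<in>{1..} \<times> sphere 0 1. G t u / t powr q)"
  have "c * t ^ (DIM('a) - 1) \<le> G t u" if t: "1 \<le> t" and u: "norm u = 1" for t u
  proof -
    have "bdd_below ((\<lambda>(t, u). G t u / t powr q) ` ({1..} \<times> sphere 0 1))"
      by (intro bdd_belowI[of _ 0]) (auto intro!: divide_nonneg_nonneg less_imp_le[OF class_G_I_dest(2)[OF G]])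
    then have "c \<le> (\<lambda>(t, u). G t u / t powr q) (t, u)"
      unfolding c_def by (rule cINF_lower) (use t u in auto)
    then have "c * t powr q \<le> G t u" using t by (simp add: field_simps)
    moreover have "t ^ (DIM('a) - 1) \<le> t powr q"
    proof -
      have "t ^ (DIM('a) - 1) = t powr real (DIM('a) - 1)" using t by (intro powr_realpow[symmetric]) simp
      also have "\<dots> \<le> t powr q" using t q by (intro powr_mono) (auto simp: of_nat_diff)
      finally show ?thesis .
    qed
    then have "c * t ^ (DIM('a) - 1) \<le> c * t powr q" using INF by (intro mult_left_mono) (auto simp: c_def)
    ultimately show ?thesis by linarith
  qed
  then show ?thesis
    unfolding sphere_growth_def using INF by (intro exI[of _ c] exI[of _ 1] conjI) (auto simp: c_def)
qed

lemma Orlicz_minimizer: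
  fixes M :: "'a::euclidean_space measure"
  assumes "2 \<le> DIM('a)" "\<phi> \<in> class_I" "finite_measure M"
    and "sets M = sets (restrict_space borel (sphere 0 1))" "emeasure M (space M) \<noteq> 0"
    and "not_concentrated_on_closed_hemisphere M"
    and "G \<in> class_G_I" "sphere_growth G"
  shows "(\<exists>Q\<in>B_tilde G. (\<integral>u. \<phi> (support_fun Q u) \<partial>M)
            = (INF Q\<in>B_tilde G. \<integral>u. \<phi> (support_fun Q u) \<partial>M)) \<and>
      (convex_on {0<..} \<phi> \<and> (\<forall>u\<in>sphere 0 1. convex_on {0<..} (\<lambda>t. G t u)) \<longrightarrow>
        (\<exists>!Q. Q \<in> B_tilde G \<and> (\<integral>u. \<phi> (support_fun Q u) \<partial>M)
            = (INF Q\<in>B_tilde G. \<integral>u. \<phi> (support_fun Q u) \<partial>M)))"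
  unfolding Orlicz_inf_def[symmetric]
  using Orlicz_minimizer_exists[OF assms(1-4,6-8)] Orlicz_minimizer_unique[OF assms(1-5,7-8)] by blast

lemma convex_on_rescale:
  fixes f :: "real \<Rightarrow> real"
  assumes "convex_on {0<..} f" "0 < r"
  shows "convex_on {0<..} (\<lambda>t. f (t / r))"
proof (rule convex_onI)
  fix t x y :: real assume t: "0 < t" "t < 1" "x \<in> {0<..}" "y \<in> {0<..}"
  have "f ((1 - t) *\<^sub>R (x / r) + t *\<^sub>R (y / r)) \<le> (1 - t) * f (x / r) + t * f (y / r)"
    using t assms(2) by (intro convex_onD[OF assms(1)]) auto
  then show "f (((1 - t) *\<^sub>R x + t *\<^sub>R y) / r) \<le> (1 - t) * f (x / r) + t * f (y / r)"
    by (simp add: add_divide_distrib)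
qed simp

theorem theorem4p7:
  fixes \<phi> :: "real \<Rightarrow> real"
    and \<mu> :: "'a::euclidean_space measure"
    and G :: "real \<Rightarrow> 'a \<Rightarrow> real"
  assumes "DIM('a) \<ge> 2"
    and "\<phi> \<in> class_I"
    and "finite_borel_measure_on_sphere \<mu>"
    and "emeasure \<mu> (space \<mu>) \<noteq> 0"
    and "not_concentrated_on_closed_hemisphere \<mu>"
    and "G \<in> class_G_I"
    and "\<exists>q. q \<ge> real DIM('a) - 1 \<and> (INF (t, u)\<in>{1..} \<times> sphere 0 1. G t u / t powr q) > 0"
  shows
    "((\<exists>M\<in>B_tilde G. (\<integral>u. \<phi> (support_fun M u) \<partial>\<mu>)
          = (INF Q\<in>B_tilde G. \<integral>u. \<phi> (support_fun Q u) \<partial>\<mu>)) \<and>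
      (convex_on {0<..} \<phi> \<and> (\<forall>u\<in>sphere 0 1. convex_on {0<..} (\<lambda>t. G t u)) \<longrightarrow>
        (\<exists>!M. M \<in> B_tilde G \<and> (\<integral>u. \<phi> (support_fun M u) \<partial>\<mu>)
          = (INF Q\<in>B_tilde G. \<integral>u. \<phi> (support_fun Q u) \<partial>\<mu>)))) \<and>
     ((\<exists>M\<in>B_hat G. (\<integral>u. \<phi> (support_fun M u) \<partial>\<mu>)
          = (INF Q\<in>B_hat G. \<integral>u. \<phi> (support_fun Q u) \<partial>\<mu>)) \<and>
      (convex_on {0<..} \<phi> \<and> (\<forall>u\<in>sphere 0 1. convex_on {0<..} (\<lambda>t. G t u)) \<longrightarrow>
        (\<exists>!M. M \<in> B_hat G \<and> (\<integral>u. \<phi> (support_fun M u) \<partial>\<mu>)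
          = (INF Q\<in>B_hat G. \<integral>u. \<phi> (support_fun Q u) \<partial>\<mu>))))"
proof -
  have \<mu>: "finite_measure \<mu>" "sets \<mu> = sets (restrict_space borel (sphere 0 1))"
    using assms(3) by (auto simp: finite_borel_measure_on_sphere_def)
  have gr: "sphere_growth G" using assms(7) sphere_growth_of_INF[OF assms(6)] by blast
  obtain r where r: "0 < r" and hat: "B_hat G = B_tilde (\<lambda>t. G (t / r))"
    using B_hat_eq_B_tilde[OF assms(1,6) gr] by metis
  \<comment> \<open>Carries the convexity hypothesis over to the rescaled integrand, as the
    uniqueness clause for \<open>B_hat\<close> demands.\<close>
  have "convex_on {0<..} (\<lambda>t. G (t / r) u)" if "convex_on {0<..} (\<lambda>t. G t u)" for u
    using convex_on_rescale[OF that r] .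
  then show ?thesis
    unfolding hat
    using Orlicz_minimizer[OF assms(1,2) \<mu> assms(4,5,6) gr]
      Orlicz_minimizer[OF assms(1,2) \<mu> assms(4,5) class_G_I_rescale[OF assms(6) r] sphere_growth_rescale[OF gr r]]
    by blast
qed

end
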